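(* Let $A$ be an $n\times n$ real matrix with minimal polynomial $\phi_A(t)=\prod_{i=1}^k(t-\gamma_i)^{m_i}$ ($\gamma_i\ne\gamma_j$ for $i\neq j$), let $\eta,\zeta\in\mathbb R^n\setminus\{0\}$ and $0<a<b$. With $P_i(A)$ the matrices defined in the context, put $$J(A,\eta,\zeta)=\sum_{i=1}^{k}\sum_{j=0}^{m_i-1}\left|\langle(A-\gamma_iE)^jP_i(A)\eta,A^*\zeta\rangle\right| .$$ Suppose that $J(A,\eta,\zeta)\ne0$ and that the numbers $a$, $b$ are in a fixed compact subinterval of $(0,\infty)$. Then $$\left|\int_a^b\exp\left(i\langle t^A\eta,\zeta\rangle\right)\,dt\right|\le C\,J(A,\eta,\zeta)^{-1/N},$$ where $N=\deg\phi_A=m_1+m_2+\dots+m_k$ and the constant $C$ is independent of $\eta$, $\zeta$, $a$ and $b$.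
   Context: $n\ge2$. $E$ is the $n\times n$ unit matrix, $A^*$ is the adjoint (transpose) of $A$, $t^A=\exp((\log t)A)$ for $t>0$, and $\langle z,w\rangle=\sum_{i=1}^nz_iw_i$ for $z,w\in\mathbb C^n$ (bilinear, no conjugation). The $\gamma_i$ are the distinct complex roots of $\phi_A$. Let $a_i(t)=(t-\gamma_i)^{m_i}$ and choose polynomials $b_i(t)$ ($i=1,\dots,k$) with $\frac1{\phi_A(t)}=\sum_{i=1}^k\frac{b_i(t)}{a_i(t)}$. Let $P_i$ be the polynomial $P_i(t)=\frac{b_i(t)}{a_i(t)}\phi_A(t)$. Then $P_i(A)$ is the projection of $\mathbb C^n$ onto $V_i=\{z\in\mathbb C^n:(A-\gamma_iE)^{m_i}z=0\}$ along the decomposition $\mathbb C^n=V_1\oplus\dots\oplus V_k$. The constant $C$ may depend on $A$ and on the fixed compact subinterval. *)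

theory Defs
  imports
    "HOL-Analysis.Analysis"
    "HOL-Computational_Algebra.Polynomial"
    "HOL-Computational_Algebra.Fraction_Field"
begin

(* The class operations times and power on the type 'a^'n^'n act entrywise, so powers, polynomials and
   the exponential of a matrix are built from the matrix product ** . *)

definition matpow :: "'a::semiring_1^'n^'n \<Rightarrow> nat \<Rightarrow> 'a^'n^'n" where
  "matpow A k = ((\<lambda>B. A ** B) ^^ k) (mat 1)"

(* mat c is c times the unit matrix, so mat c ** B is the scalar multiple of B by c. *)

definition poly_mat :: "'a::comm_ring_1 poly \<Rightarrow> 'a^'n^'n \<Rightarrow> 'a^'n^'n" where
  "poly_mat p A = (\<Sum>i\<le>degree p. mat (coeff p i) ** matpow A i)"

definition is_minimal_poly :: "'a::field^'n^'n \<Rightarrow> 'a poly \<Rightarrow> bool" where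
  "is_minimal_poly A p \<longleftrightarrow>
     lead_coeff p = 1 \<and> poly_mat p A = 0 \<and>
     (\<forall>q. q \<noteq> 0 \<and> poly_mat q A = 0 \<longrightarrow> degree p \<le> degree q)"

definition mat_exp :: "real^'n^'n \<Rightarrow> real^'n^'n" where
  "mat_exp A = (\<Sum>k. (1 / fact k) *\<^sub>R matpow A k)"

definition mat_rpow :: "real \<Rightarrow> real^'n^'n \<Rightarrow> real^'n^'n" where
  "mat_rpow t A = mat_exp (ln t *\<^sub>R A)"

definition cvec :: "real^'n \<Rightarrow> complex^'n" where
  "cvec x = (\<chi> i. complex_of_real (x $ i))"

definition cmat :: "real^'n^'n \<Rightarrow> complex^'n^'n" where
  "cmat A = map_matrix complex_of_real A"

(* Bilinear: unlike the inner product of complex^'n, there is no conjugation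
   (and the values are complex). *)

definition bilin :: "complex^'n \<Rightarrow> complex^'n \<Rightarrow> complex" where
  "bilin z w = (\<Sum>i\<in>UNIV. z $ i * w $ i)"

abbreviation cpoly :: "real poly \<Rightarrow> complex poly" where
  "cpoly p \<equiv> map_poly complex_of_real p"

definition prim_factor :: "(nat \<Rightarrow> complex) \<Rightarrow> (nat \<Rightarrow> nat) \<Rightarrow> nat \<Rightarrow> complex poly" where
  "prim_factor \<gamma> m i = [:- \<gamma> i, 1:] ^ m i"

(* The identity 1 / \<phi> = (\<Sum>i=1..k. \<beta> i / (t - \<gamma> i) ^ m i) of rational functions. *)

definition partial_fractions ::
  "complex poly \<Rightarrow> nat \<Rightarrow> (nat \<Rightarrow> complex) \<Rightarrow> (nat \<Rightarrow> nat) \<Rightarrow> (nat \<Rightarrow> complex poly) \<Rightarrow> bool" where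
  "partial_fractions \<phi> k \<gamma> m \<beta> \<longleftrightarrow>
     Fraction_Field.Fract 1 \<phi> = (\<Sum>i=1..k. Fraction_Field.Fract (\<beta> i) (prim_factor \<gamma> m i))"

(* The division is exact when \<phi> is the product of its factors prim_factor \<gamma> m i. *)

definition proj_poly ::
  "complex poly \<Rightarrow> (nat \<Rightarrow> complex) \<Rightarrow> (nat \<Rightarrow> nat) \<Rightarrow> (nat \<Rightarrow> complex poly) \<Rightarrow> nat \<Rightarrow> complex poly" where
  "proj_poly \<phi> \<gamma> m \<beta> i = (\<beta> i * \<phi>) div prim_factor \<gamma> m i"

definition J_sum ::
  "nat \<Rightarrow> (nat \<Rightarrow> complex) \<Rightarrow> (nat \<Rightarrow> nat) \<Rightarrow> (nat \<Rightarrow> complex poly) \<Rightarrow>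
   real^'n^'n \<Rightarrow> real^'n \<Rightarrow> real^'n \<Rightarrow> real" where
  "J_sum k \<gamma> m P A \<eta> \<zeta> =
     (\<Sum>i=1..k. \<Sum>j<m i.
        cmod (bilin ((matpow (cmat A - mat (\<gamma> i)) j ** poly_mat (P i) (cmat A)) *v cvec \<eta>)
                    (cvec (transpose A *v \<zeta>))))"

end

theory Submission
  imports Defs
begin

text \<open>
  Put \<open>s = ln t\<close> and \<open>F s = \<langle>exp (s A) \<eta>, \<zeta>\<rangle>\<close>.  The integral becomes that of \<open>cis (F s) * exp s\<close>, and
  \<open>F' s = \<langle>exp (s A) \<eta>, A\<^sup>* \<zeta>\<rangle>\<close> is annihilated by \<open>\<phi>(d/ds)\<close>, because \<open>\<phi>(A) = 0\<close>.  A solution of a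
  linear differential equation of order \<open>N\<close> is determined by its first \<open>N\<close> derivatives at any single
  point, so these cannot be small simultaneously.  Quantitatively, a Gronwall argument shows that the
  sum of the squares of the derivatives of \<open>F\<close> of orders \<open>1, ..., N\<close> varies on a compact interval at
  most by a constant factor, so it is everywhere comparable to its value \<open>U\<^sup>2\<close> at \<open>s = 0\<close>
  (\<open>energy_comparable\<close>).

  Hence near every point some derivative of \<open>F\<close> of order \<open>l \<le> N\<close> is at least a constant times \<open>U\<close>, and
  since all these derivatives are also at most a constant times \<open>U\<close>, this persists on intervals whose
  length does not depend on \<open>\<eta>\<close>, \<open>\<zeta>\<close>.  On each of these boundedly many intervals the lemma of van der
  Corput (\<open>van_der_Corput\<close>) gives the bound \<open>U powr (- 1 / l)\<close> up to a constant.  For \<open>U \<ge> 1\<close> this is at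
  most \<open>U powr (- 1 / N)\<close>; for \<open>U < 1\<close> the trivial bound suffices
  (\<open>oscillatory_integral_ode_bound\<close>).

  It remains to pass from \<open>U\<close> to \<open>J\<close>; as the exponent is negative, this means \<open>J \<le> C * U\<close>
  (\<open>J_sum_le_orbit_size\<close>).  The matrices in \<open>J\<close> are polynomials in \<open>A\<close>, and every
  \<open>\<langle>A\<^sup>l \<eta>, A\<^sup>* \<zeta>\<rangle>\<close> is a combination of those with \<open>l < N\<close> by the recurrence that \<open>\<phi>(A) = 0\<close> imposes.
  The numbers \<open>\<langle>A\<^sup>l \<eta>, A\<^sup>* \<zeta>\<rangle>\<close> with \<open>l < N\<close> are exactly the derivatives of \<open>F\<close> at \<open>0\<close> that make up \<open>U\<close>.
  The constant \<open>C\<close> depends on the numerators \<open>\<beta>\<close> of the partial fractions only in appearance: two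
  choices change each \<open>P\<^sub>i\<close> by a multiple of \<open>\<phi>\<close> (\<open>proj_poly_unique\<close>), hence leave \<open>P\<^sub>i(A)\<close> and \<open>J\<close>
  unchanged.
\<close>

section \<open>The lemma of van der Corput with an amplitude\<close>

text \<open>
  Here \<open>D 0\<close> is the phase, \<open>D l\<close> its derivative of order \<open>l\<close>, and \<open>\<psi>\<close> the amplitude.  The bound on
  \<open>\<psi>'\<close> is scaled by the length of the interval so that the total variation of \<open>\<psi>\<close> on every
  subinterval is at most \<open>B\<close>, the same constant that bounds \<open>\<psi>\<close> itself.
\<close>

locale oscillation =
  fixes D :: "nat \<Rightarrow> real \<Rightarrow> real" and \<psi> \<psi>' :: "real \<Rightarrow> real" and \<alpha> \<beta> B :: real
  assumes D_deriv: "(D l has_real_derivative D (Suc l) s) (at s)"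
    and \<psi>_deriv: "(\<psi> has_real_derivative \<psi>' s) (at s)"
    and \<psi>'_cont: "continuous_on {\<alpha>..\<beta>} \<psi>'"
    and \<psi>_bound: "s \<in> {\<alpha>..\<beta>} \<Longrightarrow> \<bar>\<psi> s\<bar> \<le> B"
    and \<psi>'_bound: "s \<in> {\<alpha>..\<beta>} \<Longrightarrow> (\<beta> - \<alpha>) * \<bar>\<psi>' s\<bar> \<le> B"
begin

definition osc_integral :: "real \<Rightarrow> real \<Rightarrow> complex" where
  "osc_integral p q = integral {p..q} (\<lambda>s. cis (D 0 s) * complex_of_real (\<psi> s))"

lemma continuous_on_D [continuous_intros]: "continuous_on S f \<Longrightarrow> continuous_on S (\<lambda>s. D l (f s))"
proof -
  have "continuous_on UNIV (D l)"
    by (meson D_deriv DERIV_continuous_on has_field_derivative_at_within)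
  then show "continuous_on S f \<Longrightarrow> continuous_on S (\<lambda>s. D l (f s))"
    by (rule continuous_on_compose2) auto
qed

lemma continuous_on_\<psi> [continuous_intros]: "continuous_on S f \<Longrightarrow> continuous_on S (\<lambda>s. \<psi> (f s))"
proof -
  have "continuous_on UNIV \<psi>"
    by (meson \<psi>_deriv DERIV_continuous_on has_field_derivative_at_within)
  then show "continuous_on S f \<Longrightarrow> continuous_on S (\<lambda>s. \<psi> (f s))"
    by (rule continuous_on_compose2) auto
qed

lemma integrand_integrable: "(\<lambda>s. cis (D 0 s) * complex_of_real (\<psi> s)) integrable_on {p..q}"
  by (intro integrable_continuous_interval continuous_intros)

lemma osc_integral_combine:
  "p \<le> r \<Longrightarrow> r \<le> q \<Longrightarrow> osc_integral p q = osc_integral p r + osc_integral r q"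
  unfolding osc_integral_def
  by (subst Henstock_Kurzweil_Integration.integral_combine[of p r q]) (auto intro: integrand_integrable)

lemma osc_integral_trivial:
  assumes "\<alpha> \<le> p" "p \<le> q" "q \<le> \<beta>"
  shows "cmod (osc_integral p q) \<le> B * (q - p)"
  unfolding osc_integral_def
  by (rule integral_bound)
     (use assms \<psi>_bound in \<open>auto intro!: continuous_intros simp: norm_mult\<close>)

lemma B_nonneg: "\<alpha> \<le> \<beta> \<Longrightarrow> 0 \<le> B"
  using \<psi>_bound[of \<alpha>] by auto

text \<open>
  Integration by parts against \<open>cis F * \<i> F'\<close>: the two boundary terms and the term with \<open>\<psi>'\<close> each
  cost \<open>B / \<delta>\<close>, and the derivative of \<open>1 / F'\<close> contributes the integral of \<open>\<bar>F''\<bar> / F'\<^sup>2\<close>.  How this last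
  integral is bounded is left open; monotonicity of \<open>F'\<close> and a pointwise bound on \<open>F''\<close> are both
  used below.
\<close>

lemma osc_integral_by_parts:
  assumes "\<alpha> \<le> p" "p \<le> q" "q \<le> \<beta>" and "0 < \<delta>"
    and lower: "\<And>s. s \<in> {p..q} \<Longrightarrow> \<delta> \<le> \<bar>D 1 s\<bar>"
    and V: "integral {p..q} (\<lambda>s. \<bar>D 2 s\<bar> / (D 1 s)\<^sup>2) \<le> V"
  shows "cmod (osc_integral p q) \<le> B * (3 / \<delta> + V)"
proof -
  have nz: "D 1 s \<noteq> 0" if "s \<in> {p..q}" for s using lower[OF that] \<open>0 < \<delta>\<close> by auto
  have \<psi>'_cont': "continuous_on {p..q} \<psi>'"
    by (rule continuous_on_subset[OF \<psi>'_cont]) (use assms in auto)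
  have B0: "0 \<le> B" using B_nonneg assms by auto
  \<comment> \<open>The antiderivative of the integrand up to the error term \<open>cis F * w\<close>.\<close>
  define G where "G s = - \<i> * (cis (D 0 s) * complex_of_real (\<psi> s / D 1 s))" for s
  define w where "w s = \<psi>' s / D 1 s - \<psi> s * D 2 s / (D 1 s)\<^sup>2" for s
  have w_cont: "continuous_on {p..q} w"
    unfolding w_def by (intro continuous_intros \<psi>'_cont') (use nz in auto)
  have G_deriv: "(G has_vector_derivative
        (cis (D 0 s) * complex_of_real (\<psi> s) - \<i> * (cis (D 0 s) * complex_of_real (w s)))) (at s within {p..q})"
    if s: "s \<in> {p..q}" for s
  proof -
    have 1: "((\<lambda>s. cis (D 0 s)) has_vector_derivative (D 1 s *\<^sub>R (\<i> * cis (D 0 s)))) (at s within {p..q})"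
      using has_derivative_cis[OF D_deriv[of 0 s, unfolded has_field_derivative_def, THEN has_derivative_at_withinI, of "{p..q}"]]
      by (simp add: has_vector_derivative_def scaleR_conv_of_real mult_ac)
    have "((\<lambda>s. \<psi> s / D 1 s) has_real_derivative w s) (at s within {p..q})"
      unfolding w_def using nz[OF s]
      by (auto intro!: derivative_eq_intros \<psi>_deriv[THEN has_field_derivative_at_within]
            D_deriv[THEN has_field_derivative_at_within] simp: field_simps power2_eq_square numeral_2_eq_2)
    then have 2: "((\<lambda>s. complex_of_real (\<psi> s / D 1 s)) has_vector_derivative complex_of_real (w s)) (at s within {p..q})"
      by (auto intro: has_vector_derivative_of_real
          simp: has_real_derivative_iff_has_vector_derivative simp del: of_real_divide)
    have "(G has_vector_derivative (- \<i> * (cis (D 0 s) * complex_of_real (w s) +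
        D 1 s *\<^sub>R (\<i> * cis (D 0 s)) * complex_of_real (\<psi> s / D 1 s)))) (at s within {p..q})"
      unfolding G_def
      by (intro has_vector_derivative_mult_right has_vector_derivative_mult 1 2)
    then show ?thesis
      by (rule has_vector_derivative_eq_rhs) (use nz[OF s] in \<open>simp add: scaleR_conv_of_real field_simps\<close>)
  qed
  have FTC: "((\<lambda>s. cis (D 0 s) * complex_of_real (\<psi> s) - \<i> * (cis (D 0 s) * complex_of_real (w s)))
      has_integral (G q - G p)) {p..q}"
    by (rule fundamental_theorem_of_calculus[OF \<open>p \<le> q\<close> G_deriv])
  have w_int: "(\<lambda>s. \<i> * (cis (D 0 s) * complex_of_real (w s))) integrable_on {p..q}"
    by (intro integrable_continuous_interval continuous_intros w_cont)
  have eq: "osc_integral p q = (G q - G p) + integral {p..q} (\<lambda>s. \<i> * (cis (D 0 s) * complex_of_real (w s)))"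
    unfolding osc_integral_def
    using has_integral_add[OF FTC integrable_integral[OF w_int]] by (simp add: integral_unique)
  have G_le: "cmod (G s) \<le> B / \<delta>" if s: "s \<in> {p..q}" for s
  proof -
    have "cmod (G s) = \<bar>\<psi> s\<bar> / \<bar>D 1 s\<bar>" by (simp add: G_def norm_mult norm_divide)
    also have "\<dots> \<le> B / \<delta>"
      using s assms by (intro frac_le \<psi>_bound lower B0) auto
    finally show ?thesis .
  qed
  have w_le: "cmod (\<i> * (cis (D 0 s) * complex_of_real (w s))) \<le> \<bar>\<psi>' s\<bar> / \<delta> + B * (\<bar>D 2 s\<bar> / (D 1 s)\<^sup>2)"
    if s: "s \<in> {p..q}" for s
  proof -
    have "\<bar>w s\<bar> \<le> \<bar>\<psi>' s\<bar> / \<bar>D 1 s\<bar> + \<bar>\<psi> s\<bar> * (\<bar>D 2 s\<bar> / (D 1 s)\<^sup>2)"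
      unfolding w_def by (rule order_trans[OF abs_triangle_ineq4]) (simp add: abs_mult)
    also have "\<dots> \<le> \<bar>\<psi>' s\<bar> / \<delta> + B * (\<bar>D 2 s\<bar> / (D 1 s)\<^sup>2)"
      using s assms by (intro add_mono divide_left_mono mult_right_mono \<psi>_bound lower)
        (use nz[OF s] in auto)
    finally show ?thesis by (simp add: norm_mult)
  qed
  have int1: "(\<lambda>s. \<bar>\<psi>' s\<bar> / \<delta>) integrable_on {p..q}"
    by (intro integrable_continuous_interval continuous_intros \<psi>'_cont') (use \<open>0 < \<delta>\<close> in auto)
  have int2: "(\<lambda>s. \<bar>D 2 s\<bar> / (D 1 s)\<^sup>2) integrable_on {p..q}"
    by (intro integrable_continuous_interval continuous_intros) (use nz in auto)
  have int1_le: "integral {p..q} (\<lambda>s. \<bar>\<psi>' s\<bar> / \<delta>) \<le> B / \<delta>"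
  proof (cases "\<alpha> < \<beta>")
    case True
    have "integral {p..q} (\<lambda>s. \<bar>\<psi>' s\<bar> / \<delta>) \<le> integral {p..q} (\<lambda>s. B / (\<beta> - \<alpha>) / \<delta>)"
    proof (intro integral_le int1)
      fix s assume "s \<in> {p..q}"
      then have "\<bar>\<psi>' s\<bar> \<le> B / (\<beta> - \<alpha>)"
        using \<psi>'_bound[of s] assms True by (simp add: pos_le_divide_eq mult.commute)
      then show "\<bar>\<psi>' s\<bar> / \<delta> \<le> B / (\<beta> - \<alpha>) / \<delta>"
        using \<open>0 < \<delta>\<close> by (intro divide_right_mono) auto
    qed auto
    also have "\<dots> = (q - p) / (\<beta> - \<alpha>) * (B / \<delta>)"
      using \<open>p \<le> q\<close> by simp
    also have "\<dots> \<le> 1 * (B / \<delta>)"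
      using assms True B0 by (intro mult_right_mono) (auto simp: field_simps)
    finally show ?thesis by simp
  next
    case False
    then show ?thesis using assms B0 by (cases "p = q") auto
  qed
  have "cmod (integral {p..q} (\<lambda>s. \<i> * (cis (D 0 s) * complex_of_real (w s))))
      \<le> integral {p..q} (\<lambda>s. \<bar>\<psi>' s\<bar> / \<delta> + B * (\<bar>D 2 s\<bar> / (D 1 s)\<^sup>2))"
    by (rule integral_norm_bound_integral[OF w_int _ w_le])
       (intro integrable_add int1 integrable_on_mult_right int2)
  also have "\<dots> = integral {p..q} (\<lambda>s. \<bar>\<psi>' s\<bar> / \<delta>) + B * integral {p..q} (\<lambda>s. \<bar>D 2 s\<bar> / (D 1 s)\<^sup>2)"
    by (simp only: integral_add[OF int1 integrable_on_mult_right[OF int2]] integral_mult_right)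
  also have "\<dots> \<le> B / \<delta> + B * V"
    using int1_le V B0 by (intro add_mono mult_left_mono) auto
  finally have "cmod (osc_integral p q) \<le> cmod (G q - G p) + (B / \<delta> + B * V)"
    unfolding eq by (intro norm_triangle_le add_left_mono)
  also have "cmod (G q - G p) \<le> B / \<delta> + B / \<delta>"
    using G_le[of p] G_le[of q] \<open>p \<le> q\<close> norm_triangle_ineq4[of "G q" "G p"] by auto
  finally show ?thesis by (simp add: algebra_simps)
qed

text \<open>
  If \<open>F'\<close> is monotone, then \<open>\<bar>F''\<bar> / F'\<^sup>2\<close> is, up to a sign, the derivative of \<open>1 / F'\<close>.
\<close>

lemma osc_integral_one_signed:
  assumes "\<alpha> \<le> p" "p \<le> q" "q \<le> \<beta>" and "0 < \<delta>"
    and lower: "\<And>s. s \<in> {p..q} \<Longrightarrow> \<delta> \<le> \<bar>D 1 s\<bar>"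
    and sign: "\<And>s. s \<in> {p..q} \<Longrightarrow> \<bar>D 2 s\<bar> = \<sigma> * D 2 s" and \<sigma>: "\<bar>\<sigma>\<bar> = 1"
  shows "cmod (osc_integral p q) \<le> 5 * B / \<delta>"
proof -
  have nz: "D 1 s \<noteq> 0" if "s \<in> {p..q}" for s using lower[OF that] \<open>0 < \<delta>\<close> by auto
  have "((\<lambda>s. \<sigma> * D 2 s / (D 1 s)\<^sup>2) has_integral (- \<sigma> / D 1 q - (- \<sigma> / D 1 p))) {p..q}"
    by (rule fundamental_theorem_of_calculus[OF \<open>p \<le> q\<close>],
        unfold has_real_derivative_iff_has_vector_derivative[symmetric])
       (auto intro!: derivative_eq_intros D_deriv[THEN has_field_derivative_at_within] nz
          simp: power2_eq_square numeral_2_eq_2 simp del: One_nat_def)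
  then have "((\<lambda>s. \<bar>D 2 s\<bar> / (D 1 s)\<^sup>2) has_integral (- \<sigma> / D 1 q - (- \<sigma> / D 1 p))) {p..q}"
    by (rule has_integral_eq[rotated]) (auto simp: sign)
  then have "integral {p..q} (\<lambda>s. \<bar>D 2 s\<bar> / (D 1 s)\<^sup>2) = \<sigma> / D 1 p - \<sigma> / D 1 q"
    by (simp add: integral_unique)
  also have "\<dots> \<le> 1 / \<bar>D 1 p\<bar> + 1 / \<bar>D 1 q\<bar>"
    using abs_triangle_ineq4[of "\<sigma> / D 1 p" "\<sigma> / D 1 q"] \<sigma> by (simp add: abs_divide)
  also have "\<dots> \<le> 1 / \<delta> + 1 / \<delta>"
    using assms by (intro add_mono frac_le lower) auto
  finally have "cmod (osc_integral p q) \<le> B * (3 / \<delta> + (1 / \<delta> + 1 / \<delta>))"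
    using assms by (intro osc_integral_by_parts) auto
  then show ?thesis by (simp add: algebra_simps)
qed

lemma osc_integral_bounded_variation:
  assumes "\<alpha> \<le> p" "p \<le> q" "q \<le> \<beta>" and "0 < \<delta>"
    and lower: "\<And>s. s \<in> {p..q} \<Longrightarrow> \<delta> \<le> \<bar>D 1 s\<bar>"
    and upper: "\<And>s. s \<in> {p..q} \<Longrightarrow> \<bar>D 2 s\<bar> \<le> M * \<delta>"
  shows "cmod (osc_integral p q) \<le> B * (3 + M * (q - p)) / \<delta>"
proof -
  have nz: "D 1 s \<noteq> 0" if "s \<in> {p..q}" for s using lower[OF that] \<open>0 < \<delta>\<close> by auto
  have "\<bar>D 2 s\<bar> / (D 1 s)\<^sup>2 \<le> M / \<delta>" if s: "s \<in> {p..q}" for s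
  proof -
    have "\<bar>D 2 s\<bar> / (D 1 s)\<^sup>2 \<le> M * \<delta> / \<delta>\<^sup>2"
      using upper[OF s] power_mono[OF lower[OF s], of 2] \<open>0 < \<delta>\<close> by (intro frac_le) auto
    then show ?thesis using \<open>0 < \<delta>\<close> by (simp add: power2_eq_square)
  qed
  then have "integral {p..q} (\<lambda>s. \<bar>D 2 s\<bar> / (D 1 s)\<^sup>2) \<le> integral {p..q} (\<lambda>s. M / \<delta>)"
    by (intro integral_le integrable_continuous_interval continuous_intros) (use nz in auto)
  also have "\<dots> = M * (q - p) / \<delta>" using \<open>p \<le> q\<close> by simp
  finally have "cmod (osc_integral p q) \<le> B * (3 / \<delta> + M * (q - p) / \<delta>)"
    using assms by (intro osc_integral_by_parts) auto
  then show ?thesis by (simp add: add_divide_distrib diff_divide_distrib algebra_simps)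
qed

text \<open>
  Take \<open>z\<close> where \<open>\<bar>D l\<bar>\<close> is minimal.  By the mean value theorem \<open>D l\<close> moves by at least
  \<open>\<delta> * \<bar>s - z\<bar>\<close> between \<open>z\<close> and \<open>s\<close>, and at most half of that can be absorbed by \<open>\<bar>D l z\<bar> \<le> \<bar>D l s\<bar>\<close>.
  The minimum avoids a distinction between interior zeros and functions without zeros.
\<close>

lemma lower_bound_away_from_minimum:
  assumes "p \<le> q" and lower: "\<And>s. s \<in> {p..q} \<Longrightarrow> \<delta> \<le> \<bar>D (Suc l) s\<bar>"
  obtains z where "z \<in> {p..q}" "\<And>s. s \<in> {p..q} \<Longrightarrow> \<delta> * \<bar>s - z\<bar> \<le> 2 * \<bar>D l s\<bar>"
proof -
  have "\<exists>z\<in>{p..q}. \<forall>s\<in>{p..q}. \<bar>D l z\<bar> \<le> \<bar>D l s\<bar>"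
    by (rule continuous_attains_inf) (use \<open>p \<le> q\<close> in \<open>auto intro!: continuous_intros\<close>)
  then obtain z where z: "z \<in> {p..q}" and min: "\<And>s. s \<in> {p..q} \<Longrightarrow> \<bar>D l z\<bar> \<le> \<bar>D l s\<bar>" by blast
  have mvt: "\<delta> * (y - x) \<le> \<bar>D l y - D l x\<bar>" if "x \<in> {p..q}" "y \<in> {p..q}" "x < y" for x y
  proof -
    obtain c where c: "c > x" "c < y" "D l y - D l x = (y - x) * D (Suc l) c"
      using MVT2[OF \<open>x < y\<close>, of "D l" "D (Suc l)"] D_deriv by blast
    then show ?thesis
      using lower[of c] that by (simp add: abs_mult mult_mono mult.commute)
  qed
  have "\<delta> * \<bar>s - z\<bar> \<le> 2 * \<bar>D l s\<bar>" if s: "s \<in> {p..q}" for s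
  proof -
    have "\<delta> * \<bar>s - z\<bar> \<le> \<bar>D l s - D l z\<bar>"
      using mvt[OF s z] mvt[OF z s] by (cases s z rule: linorder_cases) auto
    also have "\<dots> \<le> \<bar>D l s\<bar> + \<bar>D l z\<bar>" by (rule abs_triangle_ineq4)
    finally show ?thesis using min[OF s] by simp
  qed
  with z that show thesis by blast
qed

text \<open>
  The sign is passed on as a factor \<open>\<sigma>\<close> so that both signs are handled at once.
\<close>

lemma one_signed:
  assumes "p \<le> q" and nz: "\<And>s. s \<in> {p..q} \<Longrightarrow> D l s \<noteq> 0"
  obtains \<sigma> where "\<bar>\<sigma>\<bar> = 1" "\<And>s. s \<in> {p..q} \<Longrightarrow> \<bar>D l s\<bar> = \<sigma> * D l s"
proof -
  have conn: "connected (D l ` {p..q})"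
    by (intro connected_continuous_image continuous_intros) auto
  have "0 \<notin> D l ` {p..q}" using nz by auto
  then have "(\<forall>s\<in>{p..q}. D l s > 0) \<or> (\<forall>s\<in>{p..q}. D l s < 0)"
    using connectedD_interval[OF conn, of _ _ 0]
    by (metis (no_types, lifting) imageI less_eq_real_def linorder_not_le nz)
  then show thesis
    using that[of 1] that[of "-1"] by fastforce
qed

text \<open>
  Induction on the order.  Away from a point \<open>z\<close> the derivative of one order less is large, and the
  neighbourhood of \<open>z\<close> of radius \<open>X\<close> is estimated trivially.  The radius
  \<open>X = \<delta> powr (- 1 / (l + 2))\<close> balances both contributions.  Only the lowest order requires a
  monotone \<open>F'\<close>; in the induction step from order 1 to order 2 this comes for free, because there
  \<open>F''\<close> has no zeros.
\<close>

theorem van_der_Corput: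
  assumes "\<alpha> \<le> p" "p \<le> q" "q \<le> \<beta>" and "0 < \<delta>"
    and lower: "\<And>s. s \<in> {p..q} \<Longrightarrow> \<delta> \<le> \<bar>D (Suc l) s\<bar>"
    and sign: "l = 0 \<Longrightarrow> \<exists>\<sigma>. \<bar>\<sigma>\<bar> = 1 \<and> (\<forall>s\<in>{p..q}. \<bar>D 2 s\<bar> = \<sigma> * D 2 s)"
  shows "cmod (osc_integral p q) \<le> 5 ^ Suc l * B * \<delta> powr (- 1 / real (Suc l))"
  using assms
proof (induction l arbitrary: p q \<delta>)
  case 0
  then obtain \<sigma> where "\<bar>\<sigma>\<bar> = 1" "\<forall>s\<in>{p..q}. \<bar>D 2 s\<bar> = \<sigma> * D 2 s" by blast
  with 0 have "cmod (osc_integral p q) \<le> 5 * B / \<delta>"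
    by (intro osc_integral_one_signed[where \<sigma> = \<sigma>]) auto
  then show ?case using \<open>0 < \<delta>\<close> by (simp add: powr_minus divide_inverse)
next
  case (Suc l)
  have B0: "0 \<le> B" using B_nonneg Suc.prems by auto
  define X where "X = \<delta> powr (- 1 / real (Suc (Suc l)))"
  have X: "0 < X" using \<open>0 < \<delta>\<close> by (simp add: X_def)
  define \<mu> where "\<mu> = \<delta> * X / 2"
  have \<mu>: "0 < \<mu>" using X \<open>0 < \<delta>\<close> by (simp add: \<mu>_def)
  have \<mu>_powr: "\<mu> powr (- 1 / real (Suc l)) \<le> 2 * X"
  proof -
    have "\<delta> * X = \<delta> powr (1 + - 1 / real (Suc (Suc l)))"
      using \<open>0 < \<delta>\<close> by (subst powr_add) (simp add: X_def)
    also have "1 + - 1 / real (Suc (Suc l)) = real (Suc l) / real (Suc (Suc l))"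
      by (simp add: field_simps)
    finally have "(\<delta> * X) powr (- 1 / real (Suc l)) = X"
      by (simp add: powr_powr X_def)
    moreover have "\<mu> powr (- 1 / real (Suc l)) = (\<delta> * X) powr (- 1 / real (Suc l)) * (1 / 2) powr (- 1 / real (Suc l))"
      using X \<open>0 < \<delta>\<close> by (subst powr_mult[symmetric]) (auto simp: \<mu>_def)
    moreover have "(1 / 2 :: real) powr (- 1 / real (Suc l)) \<le> 2"
    proof -
      have "(1 / 2 :: real) powr (- 1 / real (Suc l)) = 2 powr (1 / real (Suc l))"
        by (simp add: powr_divide powr_minus_divide)
      also have "\<dots> \<le> 2 powr 1" by (intro powr_mono) auto
      finally show ?thesis by simp
    qed
    ultimately show ?thesis using X by (simp add: mult.commute)
  qed
  obtain z where z: "z \<in> {p..q}" "\<And>s. s \<in> {p..q} \<Longrightarrow> \<delta> * \<bar>s - z\<bar> \<le> 2 * \<bar>D (Suc l) s\<bar>"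
    using lower_bound_away_from_minimum[OF \<open>p \<le> q\<close> Suc.prems(5)] by blast
  define x y where "x = max p (z - X)" and "y = min q (z + X)"
  have xy: "p \<le> x" "x \<le> y" "y \<le> q" "y - x \<le> 2 * X"
    using z(1) X by (auto simp: x_def y_def)
  have away: "\<mu> \<le> \<bar>D (Suc l) s\<bar>" if "s \<in> {p..q}" "X \<le> \<bar>s - z\<bar>" for s
    using z(2)[OF that(1)] mult_left_mono[OF that(2) less_imp_le[OF \<open>0 < \<delta>\<close>]]
    unfolding \<mu>_def by linarith
  have piece: "cmod (osc_integral u v) \<le> 5 ^ Suc l * B * (2 * X)"
    if uv: "p \<le> u" "u \<le> v" "v \<le> q" "\<And>s. s \<in> {u..v} \<Longrightarrow> \<mu> \<le> \<bar>D (Suc l) s\<bar>" for u v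
  proof -
    have "cmod (osc_integral u v) \<le> 5 ^ Suc l * B * \<mu> powr (- 1 / real (Suc l))"
    proof (rule Suc.IH)
      assume "l = 0"
      moreover have "D 2 s \<noteq> 0" if "s \<in> {u..v}" for s
        using Suc.prems(4) Suc.prems(5)[of s] uv that \<open>l = 0\<close> by (auto simp: numeral_2_eq_2)
      ultimately show "\<exists>\<sigma>. \<bar>\<sigma>\<bar> = 1 \<and> (\<forall>s\<in>{u..v}. \<bar>D 2 s\<bar> = \<sigma> * D 2 s)"
        by (metis one_signed[OF \<open>u \<le> v\<close>])
    qed (use uv \<mu> Suc.prems in auto)
    also have "\<dots> \<le> 5 ^ Suc l * B * (2 * X)"
      using \<mu>_powr B0 by (intro mult_left_mono) auto
    finally show ?thesis .
  qed
  \<comment> \<open>One of the outer intervals may degenerate to a point, where \<open>away\<close> need not hold.\<close>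
  have out: "cmod (osc_integral u v) \<le> 5 ^ Suc l * B * (2 * X)"
    if "(u = p \<and> v = x) \<or> (u = y \<and> v = q)" for u v
  proof (cases "u < v")
    case True
    then show ?thesis
      using that xy z(1) by (intro piece away) (auto simp: x_def y_def split: if_splits)
  next
    case False
    with that xy have "u = v" by auto
    then show ?thesis using B0 X by (simp add: osc_integral_def)
  qed
  have "osc_integral p q = osc_integral p x + osc_integral x y + osc_integral y q"
    using xy by (subst osc_integral_combine[of p y q], auto, subst osc_integral_combine[of p x y], auto)
  then have "cmod (osc_integral p q) \<le> cmod (osc_integral p x) + cmod (osc_integral x y) + cmod (osc_integral y q)"
    by (metis add_right_mono norm_triangle_ineq norm_triangle_le)
  also have "\<dots> \<le> 5 ^ Suc l * B * (2 * X) + B * (2 * X) + 5 ^ Suc l * B * (2 * X)"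
  proof (intro add_mono out)
    have "cmod (osc_integral x y) \<le> B * (y - x)"
      using xy Suc.prems by (intro osc_integral_trivial) auto
    also have "\<dots> \<le> B * (2 * X)" using xy B0 by (intro mult_left_mono) auto
    finally show "cmod (osc_integral x y) \<le> B * (2 * X)" .
  qed auto
  also have "\<dots> = (4 * 5 ^ Suc l + 2) * (B * X)" by (simp add: algebra_simps)
  also have "\<dots> \<le> 5 ^ Suc (Suc l) * (B * X)"
  proof (rule mult_right_mono)
    have "(2::real) \<le> 5 ^ Suc l" using one_le_power[of "5::real" l] unfolding power_Suc by linarith
    then show "4 * 5 ^ Suc l + 2 \<le> (5::real) ^ Suc (Suc l)" by simp
  qed (use B0 X in auto)
  finally show ?case by (simp add: X_def mult_ac)
qed

end

section \<open>Phases whose derivative solves a linear differential equation\<close>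

text \<open>
  Multiplied by \<open>exp (K s)\<close> the function \<open>u\<close> increases, multiplied by \<open>exp (- K s)\<close> it decreases.
\<close>

lemma gronwall_two_sided:
  fixes u u' :: "real \<Rightarrow> real"
  assumes deriv: "\<And>s. (u has_real_derivative u' s) (at s)"
    and bound: "\<And>s. \<bar>u' s\<bar> \<le> K * u s"
  shows "u s \<le> exp (K * \<bar>s\<bar>) * u 0" and "u 0 \<le> exp (K * \<bar>s\<bar>) * u s"
proof -
  have up: "exp (K * x) * u x \<le> exp (K * y) * u y" if "x \<le> y" for x y
  proof (rule DERIV_nonneg_imp_nondecreasing[OF that])
    fix s
    have "((\<lambda>s. exp (K * s) * u s) has_real_derivative exp (K * s) * (K * u s + u' s)) (at s)"
      by (auto intro!: derivative_eq_intros deriv simp: algebra_simps)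
    moreover have "0 \<le> exp (K * s) * (K * u s + u' s)" using bound[of s] by auto
    ultimately show "\<exists>y. ((\<lambda>s. exp (K * s) * u s) has_real_derivative y) (at s) \<and> 0 \<le> y" by blast
  qed
  have down: "exp (- (K * y)) * u y \<le> exp (- (K * x)) * u x" if "x \<le> y" for x y
  proof (rule DERIV_nonpos_imp_nonincreasing[OF that])
    fix s
    have "((\<lambda>s. exp (- (K * s)) * u s) has_real_derivative exp (- (K * s)) * (u' s - K * u s)) (at s)"
      by (auto intro!: derivative_eq_intros deriv simp: algebra_simps)
    moreover have "exp (- (K * s)) * (u' s - K * u s) \<le> 0"
      using bound[of s] by (auto simp: mult_le_0_iff)
    ultimately show "\<exists>y. ((\<lambda>s. exp (- (K * s)) * u s) has_real_derivative y) (at s) \<and> y \<le> 0" by blast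
  qed
  show "u s \<le> exp (K * \<bar>s\<bar>) * u 0" "u 0 \<le> exp (K * \<bar>s\<bar>) * u s"
    using up[of 0 s] up[of s 0] down[of 0 s] down[of s 0]
    by (cases "0 \<le> s"; simp add: exp_minus field_simps)+
qed

text \<open>
  Again \<open>D 0\<close> is the phase and \<open>D l\<close> its derivative of order \<open>l\<close>.  The equation has order \<open>N\<close> as an
  equation for \<open>D 1\<close>: the phase itself enters only through its derivatives.
\<close>

locale phase_ode =
  fixes D :: "nat \<Rightarrow> real \<Rightarrow> real" and \<phi> :: "nat \<Rightarrow> real" and N :: nat
  assumes D_deriv: "(D l has_real_derivative D (Suc l) s) (at s)"
    and ode: "D (Suc N) s = - (\<Sum>r<N. \<phi> r * D (Suc r) s)"
begin

definition energy :: "real \<Rightarrow> real" where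
  "energy s = (\<Sum>l<N. (D (Suc l) s)\<^sup>2)"

lemma energy_nonneg: "0 \<le> energy s"
  by (simp add: energy_def sum_nonneg)

lemma le_energy: "l < N \<Longrightarrow> (D (Suc l) s)\<^sup>2 \<le> energy s"
  unfolding energy_def by (rule member_le_sum) auto

lemma top_le_energy: "(D (Suc N) s)\<^sup>2 \<le> (\<Sum>r<N. (\<phi> r)\<^sup>2) * energy s"
  unfolding ode energy_def power2_minus by (rule Cauchy_Schwarz_ineq_sum)

text \<open>
  The Gronwall constant of the energy: the products of neighbouring derivatives contribute \<open>2\<close>, the
  equation for the top derivative contributes the rest.
\<close>

definition rate :: real where "rate = 2 + (\<Sum>r<N. (\<phi> r)\<^sup>2)"

lemma rate_ge_2: "2 \<le> rate" by (simp add: rate_def sum_nonneg)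

text \<open>
  In the derivative of the energy all products are of neighbouring derivatives; the single one that
  leaves the range of the energy, with \<open>D (Suc N)\<close>, is brought back by the equation and the
  Cauchy-Schwarz inequality.
\<close>

lemma energy_growth:
  "energy s \<le> exp (rate * \<bar>s\<bar>) * energy 0" "energy 0 \<le> exp (rate * \<bar>s\<bar>) * energy s"
proof -
  define e' where "e' s = (\<Sum>l<N. 2 * D (Suc l) s * D (Suc (Suc l)) s)" for s
  have "(energy has_real_derivative e' s) (at s)" for s
    unfolding energy_def e'_def by (auto intro!: derivative_eq_intros D_deriv sum.cong)
  moreover have "\<bar>e' s\<bar> \<le> rate * energy s" for s
  proof -
    have "\<bar>e' s\<bar> \<le> (\<Sum>l<N. (D (Suc l) s)\<^sup>2 + (D (Suc (Suc l)) s)\<^sup>2)"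
      unfolding e'_def
    proof (rule order_trans[OF sum_abs], rule sum_mono)
      fix l
      show "\<bar>2 * D (Suc l) s * D (Suc (Suc l)) s\<bar> \<le> (D (Suc l) s)\<^sup>2 + (D (Suc (Suc l)) s)\<^sup>2"
        using sum_squares_bound[of "\<bar>D (Suc l) s\<bar>" "\<bar>D (Suc (Suc l)) s\<bar>"] by (simp add: abs_mult)
    qed
    also have "\<dots> = energy s + (\<Sum>l<N. (D (Suc (Suc l)) s)\<^sup>2)"
      by (simp add: energy_def sum.distrib)
    also have "(\<Sum>l<N. (D (Suc (Suc l)) s)\<^sup>2) \<le> energy s + (D (Suc N) s)\<^sup>2"
      using sum.lessThan_Suc_shift[of "\<lambda>l. (D (Suc l) s)\<^sup>2" N] by (simp add: energy_def)
    also have "(D (Suc N) s)\<^sup>2 \<le> (\<Sum>r<N. (\<phi> r)\<^sup>2) * energy s" by (rule top_le_energy)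
    finally show ?thesis by (simp add: rate_def algebra_simps)
  qed
  ultimately show "energy s \<le> exp (rate * \<bar>s\<bar>) * energy 0" "energy 0 \<le> exp (rate * \<bar>s\<bar>) * energy s"
    by (rule gronwall_two_sided)+
qed

lemma energy_comparable:
  assumes "\<bar>s\<bar> \<le> T"
  shows "energy s \<le> exp (rate * T) * energy 0" "energy 0 \<le> exp (rate * T) * energy s"
proof -
  have *: "exp (rate * \<bar>s\<bar>) \<le> exp (rate * T)" using assms rate_ge_2 by (simp add: mult_left_mono)
  show "energy s \<le> exp (rate * T) * energy 0"
    using energy_growth(1)[of s] mult_right_mono[OF * energy_nonneg[of 0]] by linarith
  show "energy 0 \<le> exp (rate * T) * energy s"
    using energy_growth(2)[of s] mult_right_mono[OF * energy_nonneg[of s]] by linarith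
qed

text \<open>
  The largest of the \<open>N\<close> squares that sum up to the energy is at least their mean.
\<close>

lemma some_derivative_large:
  assumes "\<bar>s\<bar> \<le> T" "0 < N"
  obtains l where "l < N" "sqrt (exp (- (rate * T)) / N) * sqrt (energy 0) \<le> \<bar>D (Suc l) s\<bar>"
proof -
  have "\<exists>l<N. energy s / N \<le> (D (Suc l) s)\<^sup>2"
  proof (rule ccontr)
    assume "\<not> ?thesis"
    then have "energy s < of_nat (card {..<N}) * (energy s / N)"
      unfolding energy_def by (intro sum_bounded_above_strict) (use assms in \<open>auto simp: not_le\<close>)
    with assms show False by simp
  qed
  then obtain l where l: "l < N" "energy s / N \<le> (D (Suc l) s)\<^sup>2" by blast
  have "exp (- (rate * T)) * energy 0 \<le> energy s"
    using energy_comparable(2)[OF assms(1)] by (simp add: exp_minus field_simps)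
  then have "exp (- (rate * T)) / N * energy 0 \<le> (D (Suc l) s)\<^sup>2"
    using l(2) assms(2) by (intro order_trans[OF _ l(2)]) (simp add: divide_right_mono)
  then have "sqrt (exp (- (rate * T)) / N * energy 0) \<le> sqrt ((D (Suc l) s)\<^sup>2)" by (rule real_sqrt_le_mono)
  with l(1) that show thesis by (simp add: real_sqrt_mult real_sqrt_divide)
qed

lemma derivatives_bounded:
  assumes "\<bar>s\<bar> \<le> T" "l \<le> N"
  shows "\<bar>D (Suc l) s\<bar> \<le> sqrt (exp (rate * T) * rate) * sqrt (energy 0)"
proof -
  have "(D (Suc l) s)\<^sup>2 \<le> rate * energy s"
  proof (cases "l < N")
    case True
    have "1 * energy s \<le> rate * energy s" using rate_ge_2 energy_nonneg by (intro mult_right_mono) auto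
    then show ?thesis using le_energy[OF True, of s] by simp
  next
    case False
    have "(\<Sum>r<N. (\<phi> r)\<^sup>2) * energy s \<le> rate * energy s"
      using energy_nonneg by (intro mult_right_mono) (auto simp: rate_def)
    then show ?thesis using top_le_energy[of s] False assms by simp
  qed
  also have "\<dots> \<le> rate * (exp (rate * T) * energy 0)"
    using energy_comparable(1)[OF assms(1)] rate_ge_2 by (intro mult_left_mono) auto
  finally have "sqrt ((D (Suc l) s)\<^sup>2) \<le> sqrt (rate * (exp (rate * T) * energy 0))"
    by (rule real_sqrt_le_mono)
  then show ?thesis by (simp add: real_sqrt_mult mult_ac)
qed

end

text \<open>
  The constant depends on the equation and the interval only, not on the solution.  The bounds
  \<open>\<kappa> U\<close> from below and \<open>\<Lambda> U\<close> from above scale in the same way with the size \<open>U\<close> of the solution,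
  so a derivative that is at least \<open>\<kappa> U\<close> at a point remains at least \<open>\<kappa> U / 2\<close> up to the distance
  \<open>\<rho> = \<kappa> / (2 \<Lambda>)\<close>, which does not involve \<open>U\<close>.
\<close>

theorem oscillatory_integral_ode_bound:
  fixes \<phi> :: "nat \<Rightarrow> real" and N :: nat and \<alpha> \<beta> :: real
  shows "\<exists>C\<ge>0. \<forall>D p q. phase_ode D \<phi> N \<longrightarrow> \<alpha> \<le> p \<longrightarrow> p \<le> q \<longrightarrow> q \<le> \<beta> \<longrightarrow>
    0 < phase_ode.energy D N 0 \<longrightarrow>
    cmod (integral {p..q} (\<lambda>s. cis (D 0 s) * complex_of_real (exp s)))
      \<le> C * sqrt (phase_ode.energy D N 0) powr (- 1 / real N)"
proof -
  define T where "T = max \<bar>\<alpha>\<bar> \<bar>\<beta>\<bar>"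
  define K where "K = 2 + (\<Sum>r<N. (\<phi> r)\<^sup>2)"
  define \<kappa> where "\<kappa> = sqrt (exp (- (K * T)) / N)"
  define \<Lambda> where "\<Lambda> = sqrt (exp (K * T) * K)"
  define \<rho> where "\<rho> = \<kappa> / (2 * \<Lambda>)"
  define B where "B = exp \<beta> * (1 + \<bar>\<beta> - \<alpha>\<bar>)"
  define n where "n = nat \<lceil>(\<beta> - \<alpha>) / \<rho>\<rceil>"
  define C1 where "C1 = 5 ^ N * B * (2 / \<kappa>)"
  define C where "C = real n * C1 + B * \<bar>\<beta> - \<alpha>\<bar>"
  have K: "2 \<le> K" by (simp add: K_def sum_nonneg)
  have T: "0 \<le> T" by (simp add: T_def)
  have B: "0 \<le> B" by (simp add: B_def)
  have "0 \<le> \<kappa>" by (simp add: \<kappa>_def)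
  then have C1: "0 \<le> C1" using B by (simp add: C1_def)
  show ?thesis
  proof (intro exI[of _ C] conjI allI impI)
    show "0 \<le> C" using C1 B by (simp add: C_def)
  next
    fix D p0 q0
    assume ode: "phase_ode D \<phi> N" and range: "\<alpha> \<le> p0" "p0 \<le> q0" "q0 \<le> \<beta>"
      and pos: "0 < phase_ode.energy D N 0"
    interpret phase_ode D \<phi> N by fact
    interpret oscillation D exp exp \<alpha> \<beta> B
    proof
      fix s assume s: "s \<in> {\<alpha>..\<beta>}"
      then have le: "exp s \<le> exp \<beta>" by simp
      also have "\<dots> \<le> B" unfolding B_def by simp
      finally show "\<bar>exp s\<bar> \<le> B" by simp
      have "(\<beta> - \<alpha>) * \<bar>exp s\<bar> \<le> (1 + \<bar>\<beta> - \<alpha>\<bar>) * exp \<beta>"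
        using s le by (intro mult_mono) auto
      then show "(\<beta> - \<alpha>) * \<bar>exp s\<bar> \<le> B" by (simp add: B_def mult.commute)
    qed (use D_deriv DERIV_exp continuous_on_exp[OF continuous_on_id] in auto)
    define U where "U = sqrt (energy 0)"
    have U: "0 < U" using pos by (simp add: U_def)
    have N: "0 < N" using pos unfolding energy_def by (cases N) auto
    have rate: "rate = K" by (simp add: rate_def K_def)
    have abs_T: "\<bar>s\<bar> \<le> T" if "s \<in> {\<alpha>..\<beta>}" for s using that by (auto simp: T_def)
    have \<kappa>: "0 < \<kappa>" using N by (simp add: \<kappa>_def)
    have \<kappa>1: "\<kappa> \<le> 1"
    proof -
      have "exp (- (K * T)) \<le> 1" using K T by simp
      also have "1 \<le> real N" using N by simp
      finally show ?thesis using N by (simp add: \<kappa>_def pos_divide_le_eq)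
    qed
    have \<Lambda>: "0 < \<Lambda>" using K by (simp add: \<Lambda>_def)
    have \<rho>: "0 < \<rho>" using \<kappa> \<Lambda> by (simp add: \<rho>_def)
    have upper: "\<bar>D (Suc l) s\<bar> \<le> \<Lambda> * U" if "s \<in> {\<alpha>..\<beta>}" "l \<le> N" for l s
      using derivatives_bounded[OF abs_T that(2), OF that(1)] by (simp add: rate \<Lambda>_def U_def)
    have short: "cmod (osc_integral p q) \<le> C1 * U powr (- 1 / real N)"
      if pq: "\<alpha> \<le> p" "p \<le> q" "q \<le> \<beta>" "q - p \<le> \<rho>" and "1 \<le> U" for p q
    proof -
      define \<delta> where "\<delta> = \<kappa> / 2 * U"
      have \<delta>: "0 < \<delta>" using \<kappa> U by (simp add: \<delta>_def)
      have "p \<in> {\<alpha>..\<beta>}" using pq by auto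
      then obtain l where l: "l < N" and large: "\<kappa> * U \<le> \<bar>D (Suc l) p\<bar>"
        using some_derivative_large[OF abs_T N] by (metis U_def \<kappa>_def rate)
      have lower: "\<delta> \<le> \<bar>D (Suc l) s\<bar>" if s: "s \<in> {p..q}" for s
      proof -
        have "norm (D (Suc l) s - D (Suc l) p) \<le> \<Lambda> * U * norm (s - p)"
        proof (rule field_differentiable_bound[of "{p..q}"])
          show "(D (Suc l) has_field_derivative D (Suc (Suc l)) x) (at x within {p..q})" for x
            by (rule D_deriv[THEN has_field_derivative_at_within])
          show "norm (D (Suc (Suc l)) x) \<le> \<Lambda> * U" if "x \<in> {p..q}" for x
            using upper[of x "Suc l"] that pq l by auto
        qed (use s pq in auto)
        also have "\<dots> \<le> \<Lambda> * U * \<rho>" using s pq \<Lambda> U by (intro mult_left_mono) auto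
        also have "\<dots> = \<delta>" using \<Lambda> by (simp add: \<rho>_def \<delta>_def)
        finally show ?thesis using large unfolding \<delta>_def real_norm_def by linarith
      qed
      have "cmod (osc_integral p q) \<le> 5 ^ Suc l * B * \<delta> powr (- 1 / real (Suc l))"
      \<comment> \<open>A large first derivative may fail to be monotone, but the upper bound \<open>\<Lambda> U\<close> for the second
        derivative is of the same order and controls its variation.\<close>
      proof (cases "l = 0")
        case True
        have "cmod (osc_integral p q) \<le> B * (3 + 2 * \<Lambda> / \<kappa> * (q - p)) / \<delta>"
        proof (rule osc_integral_bounded_variation[OF pq(1-3) \<delta>])
          show "\<bar>D 2 s\<bar> \<le> 2 * \<Lambda> / \<kappa> * \<delta>" if "s \<in> {p..q}" for s
            using upper[of s 1] that pq N \<kappa> by (auto simp: \<delta>_def numeral_2_eq_2)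
        qed (use lower True in auto)
        also have "\<dots> \<le> B * (3 + 2 * \<Lambda> / \<kappa> * \<rho>) / \<delta>"
          using pq \<kappa> \<Lambda> B \<delta> by (intro divide_right_mono mult_left_mono add_left_mono) auto
        also have "\<dots> \<le> 5 * B / \<delta>"
          using \<kappa> \<Lambda> \<delta> B by (intro divide_right_mono) (auto simp: \<rho>_def)
        finally show ?thesis using True \<delta> by (simp add: powr_minus divide_inverse)
      next
        case False
        then show ?thesis using pq(1-3) \<delta> lower by (intro van_der_Corput) auto
      qed
      also have "\<delta> powr (- 1 / real (Suc l)) = (\<kappa> / 2) powr (- 1 / real (Suc l)) * U powr (- 1 / real (Suc l))"
        unfolding \<delta>_def by (rule powr_mult)
      also have "5 ^ Suc l * B * \<dots> \<le> 5 ^ N * B * ((\<kappa> / 2) powr - 1 * U powr (- 1 / real N))"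
      proof (intro mult_mono)
        show "(5::real) ^ Suc l \<le> 5 ^ N" using l by (intro power_increasing) auto
        show "(\<kappa> / 2) powr (- 1 / real (Suc l)) \<le> (\<kappa> / 2) powr - 1"
          using \<kappa> \<kappa>1 by (intro powr_mono') auto
        show "U powr (- 1 / real (Suc l)) \<le> U powr (- 1 / real N)"
          using l \<open>1 \<le> U\<close> by (intro powr_mono) (auto simp: field_simps)
      qed (use B in auto)
      also have "\<dots> = C1 * U powr (- 1 / real N)"
        using \<kappa> by (simp add: C1_def powr_minus)
      finally show ?thesis .
    qed
    have subdivide: "cmod (osc_integral p q) \<le> real j * (C1 * U powr (- 1 / real N))"
      if "\<alpha> \<le> p" "p \<le> q" "q \<le> \<beta>" "q - p \<le> real j * \<rho>" and "1 \<le> U" for j p q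
      using that
    proof (induction j arbitrary: p)
      case 0
      then show ?case by (simp add: osc_integral_def)
    next
      case (Suc j)
      define r where "r = min q (p + \<rho>)"
      have r: "p \<le> r" "r \<le> q" "r - p \<le> \<rho>" using Suc.prems \<rho> by (auto simp: r_def)
      have "q - r \<le> real j * \<rho>" using Suc.prems(4) \<rho> by (auto simp: r_def min_def algebra_simps)
      then have "cmod (osc_integral r q) \<le> real j * (C1 * U powr (- 1 / real N))"
        using Suc.prems r by (intro Suc.IH) auto
      moreover have "cmod (osc_integral p r) \<le> C1 * U powr (- 1 / real N)"
        using Suc.prems r by (intro short) auto
      ultimately show ?case
        unfolding osc_integral_combine[OF r(1,2)]
        by (intro norm_triangle_le) (simp add: algebra_simps)
    qed
    have "cmod (osc_integral p0 q0) \<le> C * U powr (- 1 / real N)"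
    proof (cases "1 \<le> U")
      case True
      have "q0 - p0 \<le> \<beta> - \<alpha>" using range by simp
      also have "\<dots> \<le> real n * \<rho>"
        unfolding n_def using \<rho> by (simp add: pos_divide_le_eq[symmetric] of_nat_nat real_nat_ceiling_ge)
      finally have "cmod (osc_integral p0 q0) \<le> real n * (C1 * U powr (- 1 / real N))"
        using range True by (intro subdivide) auto
      also have "\<dots> \<le> C * U powr (- 1 / real N)"
        unfolding C_def using B by (simp add: algebra_simps)
      finally show ?thesis .
    next
      case False
      have "cmod (osc_integral p0 q0) \<le> B * (q0 - p0)"
        using range by (intro osc_integral_trivial)
      also have "\<dots> \<le> C"
        unfolding C_def using range B C1 by (intro add_increasing mult_left_mono) auto
      also have "C * 1 \<le> C * U powr (- 1 / real N)"
      proof (rule mult_left_mono)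
        have "U powr 0 \<le> U powr (- 1 / real N)" using False U by (intro powr_mono') auto
        then show "1 \<le> U powr (- 1 / real N)" using U by simp
      qed (use C1 B in \<open>simp add: C_def\<close>)
      finally show ?thesis by simp
    qed
    then show "cmod (integral {p0..q0} (\<lambda>s. cis (D 0 s) * complex_of_real (exp s)))
      \<le> C * sqrt (energy 0) powr (- 1 / real N)"
      by (simp add: osc_integral_def U_def)
  qed
qed

section \<open>Polynomials in a matrix\<close>

lemma matpow_0 [simp]: "matpow A 0 = mat 1" by (simp add: matpow_def)

lemma matpow_Suc: "matpow A (Suc k) = A ** matpow A k" by (simp add: matpow_def)

lemma matpow_add: "matpow A (i + j) = matpow A i ** matpow A j"
  by (induction i) (simp_all add: matpow_Suc matrix_mul_assoc)

lemma matpow_Suc_right: "matpow A (Suc k) = matpow A k ** A"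
  using matpow_add[of A k 1] by (simp add: matpow_Suc)

lemma mat_mult_nth [simp]: "(mat c ** B) $ i $ j = c * B $ i $ j"
  for B :: "'a::comm_semiring_1^'n^'m"
  by (simp add: matrix_matrix_mult_def mat_def if_distrib if_distribR cong: if_cong)

lemma mult_mat_left_commute: "B ** (mat c ** C) = mat c ** (B ** C)"
  for B :: "'a::comm_semiring_1^'n^'m"
  by (simp add: vec_eq_iff matrix_matrix_mult_def[of B] sum_distrib_left mult_ac)

lemma mat_mult_vector: "(mat c ** B) *v x = c *s (B *v x)"
  for B :: "'a::comm_semiring_1^'n^'m"
  by (simp add: vec_eq_iff matrix_vector_mult_def sum_distrib_left mult.assoc)

lemma matrix_mult_0_right [simp]: "A ** 0 = 0" and matrix_mult_0_left [simp]: "0 ** A = 0"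
  by (simp_all add: vec_eq_iff matrix_matrix_mult_def)

lemma matrix_mult_sum_right: "A ** (\<Sum>i\<in>I. f i) = (\<Sum>i\<in>I. A ** f i)"
  for A :: "'a::comm_semiring_1^'n^'m"
  by (induction I rule: infinite_finite_induct)
     (simp_all add: matrix_add_ldistrib)

lemma matrix_sum_vector: "(\<Sum>i\<in>I. f i) *v x = (\<Sum>i\<in>I. f i *v x)"
  for f :: "_ \<Rightarrow> 'a::comm_ring_1^'n^'m"
  by (induction I rule: infinite_finite_induct) (simp_all add: matrix_vector_mult_add_rdistrib)

lemma matrix_add_rdistrib: "(B + C) ** A = B ** A + C ** A"
  for A :: "'a::comm_semiring_1^'n^'m"
  by (simp add: vec_eq_iff matrix_matrix_mult_def distrib_right sum.distrib)

lemma matrix_diff_ldistrib: "A ** (B - C) = A ** B - A ** C"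
  for A :: "'a::comm_ring_1^'n^'m"
  by (simp add: vec_eq_iff matrix_matrix_mult_def right_diff_distrib sum_subtractf)

lemma matrix_diff_rdistrib: "(B - C) ** A = B ** A - C ** A"
  for A :: "'a::comm_ring_1^'n^'m"
  by (simp add: vec_eq_iff matrix_matrix_mult_def left_diff_distrib sum_subtractf)

lemma poly_mat_eq_sum:
  assumes "degree p \<le> n"
  shows "poly_mat p A = (\<Sum>i\<le>n. mat (coeff p i) ** matpow A i)"
  unfolding poly_mat_def
  by (rule sum.mono_neutral_left) (use assms in \<open>auto simp: coeff_eq_0 vec_eq_iff\<close>)

lemma poly_mat_0 [simp]: "poly_mat 0 A = 0"
  by (simp add: poly_mat_def vec_eq_iff)

lemma poly_mat_add: "poly_mat (p + q) A = poly_mat p A + poly_mat q A"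
proof -
  have "poly_mat r A = (\<Sum>i\<le>max (degree p) (degree q). mat (coeff r i) ** matpow A i)"
    if "r \<in> {p, q, p + q}" for r
    using that by (intro poly_mat_eq_sum) (auto intro: degree_add_le)
  then show ?thesis
    by (simp add: sum.distrib[symmetric] vec_eq_iff distrib_right)
qed

lemma poly_mat_smult: "poly_mat (smult c p) A = mat c ** poly_mat p A"
  unfolding poly_mat_eq_sum[OF degree_smult_le]
  by (simp add: poly_mat_def vec_eq_iff sum_distrib_left mult.assoc)

text \<open>
  With this Horner form, products of polynomials are handled by induction on the polynomial.
\<close>

lemma poly_mat_pCons: "poly_mat (pCons a p) A = mat a + A ** poly_mat p A"
proof -
  have "poly_mat (pCons a p) A = (\<Sum>i\<le>Suc (degree p). mat (coeff (pCons a p) i) ** matpow A i)"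
    by (intro poly_mat_eq_sum) (simp add: degree_pCons_le)
  also have "\<dots> = mat a + (\<Sum>i\<le>degree p. A ** (mat (coeff p i) ** matpow A i))"
    by (subst sum.atMost_Suc_shift)
       (simp add: matpow_Suc mult_mat_left_commute)
  finally show ?thesis by (simp add: matrix_mult_sum_right poly_mat_def)
qed

lemma poly_mat_mult: "poly_mat (p * q) A = poly_mat p A ** poly_mat q A"
  for A :: "'a::comm_ring_1^'n^'n"
proof (induction p)
  case (pCons a p)
  have "mat (0::'a) = (0 :: 'a^'n^'n)" by simp
  then show ?case
    using pCons
    by (simp add: poly_mat_add poly_mat_smult poly_mat_pCons matrix_add_rdistrib matrix_mul_assoc)
qed simp

lemma poly_mat_dvd_0: "p dvd q \<Longrightarrow> poly_mat p A = 0 \<Longrightarrow> poly_mat q A = 0"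
  by (auto elim!: dvdE simp: poly_mat_mult)

lemma cmat_mult: "cmat (A ** B) = cmat A ** cmat B"
  by (simp add: cmat_def vec_eq_iff matrix_matrix_mult_def)

lemma cmat_mat: "cmat (mat c) = mat (complex_of_real c)"
  by (simp add: cmat_def vec_eq_iff mat_def)

lemma cmat_matpow: "cmat (matpow A k) = matpow (cmat A) k"
  by (induction k) (simp_all add: matpow_Suc cmat_mult cmat_mat)

lemma cmat_sum: "cmat (\<Sum>i\<in>I. f i) = (\<Sum>i\<in>I. cmat (f i))"
  by (simp add: cmat_def vec_eq_iff)

lemma poly_mat_cpoly: "poly_mat (cpoly p) (cmat A) = cmat (poly_mat p A)"
  using poly_mat_eq_sum[of "cpoly p" "degree p" "cmat A"]
  by (simp add: poly_mat_def degree_map_poly coeff_map_poly cmat_sum cmat_mult cmat_mat cmat_matpow)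

lemma cmat_mult_cvec: "cmat A *v cvec x = cvec (A *v x)"
  by (simp add: cmat_def cvec_def vec_eq_iff matrix_vector_mult_def)

lemma bilin_cvec: "bilin (cvec x) (cvec y) = complex_of_real (x \<bullet> y)"
  by (simp add: bilin_def cvec_def inner_vec_def)

lemma bilin_add_left: "bilin (x + y) z = bilin x z + bilin y z"
  by (simp add: bilin_def distrib_right sum.distrib)

lemma bilin_scale_left: "bilin (c *s x) z = c * bilin x z"
  by (simp add: bilin_def sum_distrib_left mult.assoc)

lemma bilin_zero_left: "bilin 0 z = 0" by (simp add: bilin_def)

section \<open>Uniqueness of the projections modulo the minimal polynomial\<close>

text \<open>
  A factor that does not vanish at \<open>\<gamma> i\<close> does not contribute to the order of the zero there.
\<close>

lemma prim_factor_coprime_dvd: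
  assumes "prim_factor \<gamma> m i dvd d * q" and "poly q (\<gamma> i) \<noteq> 0"
  shows "prim_factor \<gamma> m i dvd d"
proof (cases "d = 0")
  case False
  have "q \<noteq> 0" "order (\<gamma> i) q = 0" using assms(2) by (auto simp: order_0I)
  then show ?thesis
    using assms(1) False unfolding prim_factor_def order_divides
    by (simp add: order_mult)
qed simp

lemma Fract_sum: "Fract (\<Sum>i\<in>I. f i) 1 = (\<Sum>i\<in>I. Fract (f i) (1::'a::idom))"
proof (induction I rule: infinite_finite_induct)
  case (insert x I)
  have "Fract (f x + sum f I) 1 = Fract (f x) 1 + Fract (sum f I) 1" by simp
  with insert show ?case by simp
qed (simp_all add: fract_collapse)

context
  fixes \<phi> :: "complex poly" and k :: nat and \<gamma> :: "nat \<Rightarrow> complex" and m :: "nat \<Rightarrow> nat"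
  assumes \<phi>_eq: "\<phi> = (\<Prod>i=1..k. [:- \<gamma> i, 1:] ^ m i)" and inj: "inj_on \<gamma> {1..k}"
begin

private abbreviation "cofactor i \<equiv> \<Prod>j\<in>{1..k} - {i}. prim_factor \<gamma> m j"

lemma prim_factor_cofactor: "i \<in> {1..k} \<Longrightarrow> \<phi> = prim_factor \<gamma> m i * cofactor i"
  unfolding \<phi>_eq prim_factor_def by (rule prod.remove) auto

lemma prim_factor_nonzero [simp]: "prim_factor \<gamma> m i \<noteq> 0"
  by (simp add: prim_factor_def)

lemma poly_cofactor_nonzero:
  assumes i: "i \<in> {1..k}"
  shows "poly (cofactor i) (\<gamma> i) \<noteq> 0"
proof -
  have "poly (prim_factor \<gamma> m j) (\<gamma> i) \<noteq> 0" if "j \<in> {1..k} - {i}" for j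
    using inj_onD[OF inj _ i, of j] that by (auto simp: prim_factor_def)
  then show ?thesis unfolding poly_prod by (subst prod_zero_iff) blast+
qed

lemma proj_poly_eq:
  assumes "i \<in> {1..k}"
  shows "proj_poly \<phi> \<gamma> m \<beta> i = \<beta> i * cofactor i"
proof -
  have "\<beta> i * \<phi> = \<beta> i * cofactor i * prim_factor \<gamma> m i"
    by (simp only: prim_factor_cofactor[OF assms] mult_ac)
  then show ?thesis
    unfolding proj_poly_def by (simp only: nonzero_mult_div_cancel_right[OF prim_factor_nonzero])
qed

text \<open>
  The decomposition of \<open>1 / \<phi>\<close>, multiplied by \<open>\<phi>\<close>; this turns the hypothesis on rational functions
  into one on polynomials.
\<close>

lemma proj_poly_sum:
  assumes "partial_fractions \<phi> k \<gamma> m \<beta>"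
  shows "(\<Sum>i=1..k. proj_poly \<phi> \<gamma> m \<beta> i) = 1"
proof -
  have \<phi>0: "\<phi> \<noteq> 0" by (auto simp: \<phi>_eq)
  have *: "Fract (\<beta> i) (prim_factor \<gamma> m i) * Fract \<phi> 1 = Fract (proj_poly \<phi> \<gamma> m \<beta> i) 1"
    if "i \<in> {1..k}" for i
    using proj_poly_eq[OF that] prim_factor_cofactor[OF that] by (simp add: eq_fract mult_ac)
  have "Fract 1 \<phi> * Fract \<phi> 1 = (\<Sum>i=1..k. Fract (\<beta> i) (prim_factor \<gamma> m i) * Fract \<phi> 1)"
    using assms unfolding partial_fractions_def by (simp only: sum_distrib_right)
  also have "\<dots> = (\<Sum>i=1..k. Fract (proj_poly \<phi> \<gamma> m \<beta> i) 1)"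
    by (intro sum.cong refl *)
  finally have "Fract (\<Sum>i=1..k. proj_poly \<phi> \<gamma> m \<beta> i) 1 = Fract 1 \<phi> * Fract \<phi> 1"
    by (simp only: Fract_sum)
  also have "\<dots> = Fract 1 1" using \<phi>0 by (simp add: eq_fract)
  finally have "Fract (\<Sum>i=1..k. proj_poly \<phi> \<gamma> m \<beta> i) 1 = Fract 1 1" .
  then show ?thesis by (simp add: eq_fract)
qed

text \<open>
  The differences of the \<open>P\<^sub>j\<close> sum up to \<open>0\<close>, and those with \<open>j \<noteq> i\<close> are divisible by
  \<open>(t - \<gamma>\<^sub>i) ^ m\<^sub>i\<close>.  So the one with \<open>j = i\<close> is, too.  It also contains all other factors of \<open>\<phi>\<close>.
\<close>

lemma proj_poly_unique:
  assumes pf: "partial_fractions \<phi> k \<gamma> m \<beta>" "partial_fractions \<phi> k \<gamma> m \<beta>'"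
    and i: "i \<in> {1..k}"
  shows "\<phi> dvd proj_poly \<phi> \<gamma> m \<beta> i - proj_poly \<phi> \<gamma> m \<beta>' i"
proof -
  define \<Delta> where "\<Delta> j = proj_poly \<phi> \<gamma> m \<beta> j - proj_poly \<phi> \<gamma> m \<beta>' j" for j
  have \<Delta>_eq: "\<Delta> j = (\<beta> j - \<beta>' j) * cofactor j" if "j \<in> {1..k}" for j
    using proj_poly_eq[OF that] by (simp add: \<Delta>_def left_diff_distrib)
  have "(\<Sum>j=1..k. \<Delta> j) = 0"
    using proj_poly_sum[OF pf(1)] proj_poly_sum[OF pf(2)] by (simp add: \<Delta>_def sum_subtractf)
  then have "\<Delta> i = - (\<Sum>j\<in>{1..k} - {i}. \<Delta> j)"
    using sum.remove[OF _ i, of \<Delta>] by (simp add: eq_neg_iff_add_eq_0)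
  moreover have "prim_factor \<gamma> m i dvd (\<Sum>j\<in>{1..k} - {i}. \<Delta> j)"
  proof (rule dvd_sum)
    fix j assume j: "j \<in> {1..k} - {i}"
    then have "prim_factor \<gamma> m i dvd cofactor j" using i by (intro dvd_prodI) auto
    then show "prim_factor \<gamma> m i dvd \<Delta> j" using j \<Delta>_eq[of j] by auto
  qed
  ultimately have "prim_factor \<gamma> m i dvd (\<beta> i - \<beta>' i) * cofactor i"
    using \<Delta>_eq[OF i] by simp
  then have "prim_factor \<gamma> m i dvd \<beta> i - \<beta>' i"
    by (rule prim_factor_coprime_dvd) (rule poly_cofactor_nonzero[OF i])
  then have "prim_factor \<gamma> m i * cofactor i dvd (\<beta> i - \<beta>' i) * cofactor i"
    by (rule mult_dvd_mono) simp
  then show ?thesis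
    using \<Delta>_eq[OF i] prim_factor_cofactor[OF i] by (simp add: \<Delta>_def)
qed

end

section \<open>Exponential generating functions\<close>

text \<open>
  The exponential generating function of the sequence \<open>c\<close> shifted by \<open>l\<close>; the shift is the derivative
  of order \<open>l\<close>.
\<close>

definition egf :: "(nat \<Rightarrow> real) \<Rightarrow> nat \<Rightarrow> real \<Rightarrow> real" where
  "egf c l s = (\<Sum>k. c (k + l) / fact k * s ^ k)"

context
  fixes c :: "nat \<Rightarrow> real" and M R :: real
  assumes geometric: "\<bar>c k\<bar> \<le> M * R ^ k"
begin

lemma egf_summable: "summable (\<lambda>k. c (k + l) / fact k * s ^ k)"
proof (rule summable_comparison_test')
  show "summable (\<lambda>k. M * R ^ l * ((R * \<bar>s\<bar>) ^ k /\<^sub>R fact k))"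
    by (intro summable_mult summable_exp_generic)
  show "norm (c (k + l) / fact k * s ^ k) \<le> M * R ^ l * ((R * \<bar>s\<bar>) ^ k /\<^sub>R fact k)" for k
  proof -
    have "norm (c (k + l) / fact k * s ^ k) = \<bar>c (k + l)\<bar> * (\<bar>s\<bar> ^ k / fact k)"
      by (simp add: abs_mult power_abs)
    also have "\<dots> \<le> M * R ^ (k + l) * (\<bar>s\<bar> ^ k / fact k)"
      by (intro mult_right_mono geometric) auto
    finally show ?thesis by (simp add: power_add power_mult_distrib field_simps)
  qed
qed

lemma egf_deriv: "(egf c l has_real_derivative egf c (Suc l) s) (at s)"
proof -
  have "diffs (\<lambda>k. c (k + l) / fact k) = (\<lambda>k. c (k + Suc l) / fact k)"
    by (auto simp: diffs_def fun_eq_iff)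
  then show ?thesis
    unfolding egf_def
    using termdiffs_strong_converges_everywhere[OF egf_summable, of l s] by simp
qed

text \<open>
  Shifting the sequence is differentiating the function, so a recurrence becomes a differential
  equation.
\<close>

lemma egf_linear_recurrence:
  assumes "\<And>n. c (n + N) = - (\<Sum>r<N. \<phi> r * c (n + r))"
  shows "egf c (l + N) s = - (\<Sum>r<N. \<phi> r * egf c (l + r) s)"
proof -
  have "(\<Sum>r<N. \<phi> r * egf c (l + r) s) = (\<Sum>k. \<Sum>r<N. \<phi> r * (c (k + (l + r)) / fact k * s ^ k))"
    unfolding egf_def
    by (simp only: suminf_mult[OF egf_summable, symmetric]
          suminf_sum[OF summable_mult[OF egf_summable]])
  also have "\<dots> = (\<Sum>k. - (c (k + (l + N)) / fact k * s ^ k))"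
    by (rule suminf_cong)
       (simp add: assms add.assoc[symmetric] sum_distrib_right sum_divide_distrib mult.assoc)
  also have "\<dots> = - egf c (l + N) s"
    unfolding egf_def by (rule suminf_minus[OF egf_summable])
  finally show ?thesis by simp
qed

end

lemma egf_at_0: "egf c l 0 = c l"
  unfolding egf_def powser_zero by simp

section \<open>The phase as a power series\<close>

lemma norm_matpow_vector: "norm (matpow A k *v x) \<le> onorm ((*v) A) ^ k * norm x"
  for A :: "real^'n^'n"
proof (induction k)
  case (Suc k)
  have "norm (matpow A (Suc k) *v x) \<le> onorm ((*v) A) * norm (matpow A k *v x)"
    using onorm[of "(*v) A" "matpow A k *v x"]
    by (simp add: matpow_Suc matrix_vector_mul_assoc)
  also have "\<dots> \<le> onorm ((*v) A) * (onorm ((*v) A) ^ k * norm x)"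
    by (intro mult_left_mono Suc onorm_pos_le) simp
  finally show ?case by (simp add: mult.assoc)
qed simp

text \<open>
  Column \<open>j\<close> of a power is its value at the unit vector \<open>j\<close>, which reduces the norm of a matrix to
  \<open>norm_matpow_vector\<close>.
\<close>

lemma norm_matpow: "norm (matpow A k) \<le> (real CARD('n))\<^sup>2 * onorm ((*v) A) ^ k"
  for A :: "real^'n^'n"
proof -
  let ?R = "onorm ((*v) A)"
  have entry: "\<bar>matpow A k $ i $ j\<bar> \<le> ?R ^ k" for i j
  proof -
    have "\<bar>matpow A k $ i $ j\<bar> = \<bar>(matpow A k *v axis j 1) $ i\<bar>"
      by (simp add: matrix_vector_mult_basis column_def)
    also have "\<dots> \<le> norm (matpow A k *v axis j 1)" by (rule component_le_norm_cart)
    also have "\<dots> \<le> ?R ^ k * norm (axis j (1::real) :: real^'n)" by (rule norm_matpow_vector)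
    finally show ?thesis by simp
  qed
  have "norm (matpow A k) \<le> (\<Sum>i\<in>UNIV. norm (matpow A k $ i))"
    unfolding norm_vec_def[of "matpow A k"] by (rule L2_set_le_sum) auto
  also have "\<dots> \<le> (\<Sum>i\<in>UNIV. \<Sum>j\<in>UNIV. \<bar>matpow A k $ i $ j\<bar>)"
    by (intro sum_mono norm_le_l1_cart)
  also have "\<dots> \<le> (\<Sum>i\<in>(UNIV::'n set). \<Sum>j\<in>(UNIV::'n set). ?R ^ k)"
    by (intro sum_mono entry)
  finally show ?thesis by (simp add: power2_eq_square)
qed

lemma matpow_scaleR: "matpow (s *\<^sub>R A) k = s ^ k *\<^sub>R matpow A k" for A :: "real^'n^'n"
  by (induction k)
     (simp_all add: matpow_Suc scalar_matrix_assoc[symmetric] matrix_scalar_ac)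

text \<open>
  By \<open>mat_exp_inner\<close> below, this is the derivative of order \<open>k\<close> at \<open>s = 0\<close> of the phase
  \<open>\<langle>exp (s A) \<eta>, \<zeta>\<rangle>\<close>.
\<close>

definition orbit_coeff :: "real^'n^'n \<Rightarrow> real^'n \<Rightarrow> real^'n \<Rightarrow> nat \<Rightarrow> real" where
  "orbit_coeff A \<eta> \<zeta> k = (matpow A k *v \<eta>) \<bullet> \<zeta>"

lemma orbit_coeff_geometric:
  "\<bar>orbit_coeff A \<eta> \<zeta> k\<bar> \<le> (norm \<eta> * norm \<zeta>) * onorm ((*v) A) ^ k"
proof -
  have "\<bar>orbit_coeff A \<eta> \<zeta> k\<bar> \<le> norm (matpow A k *v \<eta>) * norm \<zeta>"
    unfolding orbit_coeff_def by (rule Cauchy_Schwarz_ineq2)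
  also have "\<dots> \<le> (onorm ((*v) A) ^ k * norm \<eta>) * norm \<zeta>"
    by (intro mult_right_mono norm_matpow_vector) simp
  finally show ?thesis by (simp add: mult_ac)
qed

lemma mat_exp_inner: "(mat_exp (s *\<^sub>R A) *v \<eta>) \<bullet> \<zeta> = egf (orbit_coeff A \<eta> \<zeta>) 0 s"
  for A :: "real^'n^'n"
proof -
  have lin: "bounded_linear (\<lambda>B :: real^'n^'n. (B *v \<eta>) \<bullet> \<zeta>)"
    by (intro linear_conv_bounded_linear[THEN iffD1] linearI)
       (simp_all add: matrix_vector_mult_add_rdistrib inner_add_left scaleR_matrix_vector_assoc[symmetric])
  have "summable (\<lambda>k. (1 / fact k) *\<^sub>R matpow (s *\<^sub>R A) k)"
  proof (rule summable_comparison_test')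
    show "summable (\<lambda>k. (real CARD('n))\<^sup>2 * ((onorm ((*v) A) * \<bar>s\<bar>) ^ k /\<^sub>R fact k))"
      by (intro summable_mult summable_exp_generic)
    show "norm ((1 / fact k) *\<^sub>R matpow (s *\<^sub>R A) k)
        \<le> (real CARD('n))\<^sup>2 * ((onorm ((*v) A) * \<bar>s\<bar>) ^ k /\<^sub>R fact k)" for k
      using mult_right_mono[OF norm_matpow[of A k], of "\<bar>s\<bar> ^ k / fact k"]
      by (simp add: matpow_scaleR power_abs power_mult_distrib field_simps)
  qed
  from bounded_linear.suminf[OF lin this] show ?thesis
    unfolding mat_exp_def egf_def orbit_coeff_def
    by (simp add: matpow_scaleR scaleR_matrix_vector_assoc[symmetric] field_simps)
qed

text \<open>
  The derivatives of the phase at \<open>0\<close>, of positive order, in the form in which they occur in \<open>J\<close>.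
\<close>

lemma orbit_coeff_Suc: "orbit_coeff A \<eta> \<zeta> (Suc k) = (matpow A k *v \<eta>) \<bullet> (transpose A *v \<zeta>)"
  by (simp add: orbit_coeff_def matpow_Suc matrix_vector_mul_assoc[symmetric]
        inner_commute[of _ "_ v* _"] dot_lmul_matrix inner_commute[of \<zeta>])

lemma orbit_coeff_recurrence:
  assumes "poly_mat p A = 0" and "lead_coeff p = 1"
  shows "orbit_coeff A \<eta> \<zeta> (n + degree p) = - (\<Sum>r<degree p. coeff p r * orbit_coeff A \<eta> \<zeta> (n + r))"
proof -
  have "0 = (poly_mat p A *v (matpow A n *v \<eta>)) \<bullet> \<zeta>" using assms by simp
  also have "\<dots> = (\<Sum>r\<le>degree p. coeff p r * orbit_coeff A \<eta> \<zeta> (n + r))"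
    unfolding poly_mat_def matrix_sum_vector mat_mult_vector orbit_coeff_def
    by (simp add: inner_sum_left matrix_vector_mul_assoc matpow_add[symmetric] add.commute
          inner_scaleR_left scalar_mult_eq_scaleR)
  also have "\<dots> = (\<Sum>r<degree p. coeff p r * orbit_coeff A \<eta> \<zeta> (n + r)) + orbit_coeff A \<eta> \<zeta> (n + degree p)"
    using assms(2) by (simp add: lessThan_Suc_atMost[symmetric])
  finally show ?thesis by simp
qed

lemma phase_ode_egf:
  assumes "poly_mat p A = 0" and "lead_coeff p = 1"
  shows "phase_ode (egf (orbit_coeff A \<eta> \<zeta>)) (coeff p) (degree p)"
proof
  show "(egf (orbit_coeff A \<eta> \<zeta>) l has_real_derivative egf (orbit_coeff A \<eta> \<zeta>) (Suc l) s) (at s)" for l s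
    by (rule egf_deriv[OF orbit_coeff_geometric])
  show "egf (orbit_coeff A \<eta> \<zeta>) (Suc (degree p)) s =
      - (\<Sum>r<degree p. coeff p r * egf (orbit_coeff A \<eta> \<zeta>) (Suc r) s)" for s
    using egf_linear_recurrence[OF orbit_coeff_geometric orbit_coeff_recurrence[OF assms],
        of \<eta> \<zeta> 1 s] by simp
qed

section \<open>The sum J is dominated by the initial derivatives of the phase\<close>

text \<open>
  The square root of the energy of the phase at \<open>s = 0\<close>, that is, at \<open>t = 1\<close>.
\<close>

definition orbit_size :: "real^'n^'n \<Rightarrow> nat \<Rightarrow> real^'n \<Rightarrow> real^'n \<Rightarrow> real" where
  "orbit_size A N \<eta> \<zeta> = sqrt (\<Sum>l<N. (orbit_coeff A \<eta> \<zeta> (Suc l))\<^sup>2)"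

lemma orbit_size_nonneg: "0 \<le> orbit_size A N \<eta> \<zeta>"
  by (simp add: orbit_size_def sum_nonneg)

text \<open>
  Every term is a fixed linear combination of the first \<open>N\<close>, with coefficients that depend on the
  recurrence only.
\<close>

lemma linear_recurrence_bound:
  fixes \<phi> :: "nat \<Rightarrow> real"
  shows "\<exists>C\<ge>0. \<forall>a. (\<forall>n. a (n + N) = - (\<Sum>r<N. \<phi> r * a (n + r))) \<longrightarrow> \<bar>a l\<bar> \<le> C * sqrt (\<Sum>r<N. (a r)\<^sup>2)"
proof (induction l rule: less_induct)
  case (less l)
  show ?case
  proof (cases "l < N")
    case True
    have "\<bar>a l\<bar> \<le> 1 * sqrt (\<Sum>r<N. (a r)\<^sup>2)" for a :: "nat \<Rightarrow> real"
      using real_sqrt_le_mono[OF member_le_sum[of l "{..<N}" "\<lambda>r. (a r)\<^sup>2"]] True by simp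
    then show ?thesis by (intro exI[of _ 1]) auto
  next
    case False
    define n where "n = l - N"
    have l: "l = n + N" using False by (simp add: n_def)
    from less have "\<forall>r\<in>{..<N}. \<exists>C\<ge>0. \<forall>a. (\<forall>n. a (n + N) = - (\<Sum>r<N. \<phi> r * a (n + r)))
        \<longrightarrow> \<bar>a (n + r)\<bar> \<le> C * sqrt (\<Sum>r<N. (a r)\<^sup>2)"
      by (simp add: l)
    from bchoice[OF this] obtain C where C: "\<forall>r\<in>{..<N}. C r \<ge> 0 \<and> (\<forall>a. (\<forall>n. a (n + N) = - (\<Sum>r<N. \<phi> r * a (n + r)))
        \<longrightarrow> \<bar>a (n + r)\<bar> \<le> C r * sqrt (\<Sum>r<N. (a r)\<^sup>2))"
      ..
    show ?thesis
    proof (intro exI[of _ "\<Sum>r<N. \<bar>\<phi> r\<bar> * C r"] conjI allI impI)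
      show "0 \<le> (\<Sum>r<N. \<bar>\<phi> r\<bar> * C r)" using C by (intro sum_nonneg) auto
      fix a :: "nat \<Rightarrow> real"
      assume rec: "\<forall>n. a (n + N) = - (\<Sum>r<N. \<phi> r * a (n + r))"
      have "\<bar>a l\<bar> \<le> (\<Sum>r<N. \<bar>\<phi> r * a (n + r)\<bar>)"
        using rec by (simp add: l sum_abs)
      also have "\<dots> \<le> (\<Sum>r<N. \<bar>\<phi> r\<bar> * (C r * sqrt (\<Sum>r<N. (a r)\<^sup>2)))"
        unfolding abs_mult using C rec by (intro sum_mono mult_left_mono) auto
      finally show "\<bar>a l\<bar> \<le> (\<Sum>r<N. \<bar>\<phi> r\<bar> * C r) * sqrt (\<Sum>r<N. (a r)\<^sup>2)"
        by (simp add: sum_distrib_right mult.assoc)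
    qed
  qed
qed

text \<open>
  The bilinear form of \<open>B\<close> that occurs in \<open>J\<close> is bounded by the initial derivatives of the phase,
  uniformly in the two vectors.  The matrices with this property form a subspace, which will be
  seen to contain all polynomials in \<open>A\<close>.
\<close>

definition controlled :: "real^'n^'n \<Rightarrow> nat \<Rightarrow> complex^'n^'n \<Rightarrow> bool" where
  "controlled A N B \<longleftrightarrow> (\<exists>C\<ge>0. \<forall>\<eta> \<zeta>.
     cmod (bilin (B *v cvec \<eta>) (cvec (transpose A *v \<zeta>))) \<le> C * orbit_size A N \<eta> \<zeta>)"

lemma controlled_0: "controlled A N 0"
  unfolding controlled_def by (intro exI[of _ 0]) (simp add: bilin_zero_left)

lemma controlled_add:
  assumes "controlled A N B" "controlled A N B'"
  shows "controlled A N (B + B')"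
proof -
  obtain C where C: "C \<ge> 0" "\<And>\<eta> \<zeta>. cmod (bilin (B *v cvec \<eta>) (cvec (transpose A *v \<zeta>))) \<le> C * orbit_size A N \<eta> \<zeta>"
    using assms(1) unfolding controlled_def by blast
  obtain C' where C': "C' \<ge> 0" "\<And>\<eta> \<zeta>. cmod (bilin (B' *v cvec \<eta>) (cvec (transpose A *v \<zeta>))) \<le> C' * orbit_size A N \<eta> \<zeta>"
    using assms(2) unfolding controlled_def by blast
  show ?thesis
    unfolding controlled_def
  proof (intro exI[of _ "C + C'"] conjI allI)
    fix \<eta> \<zeta>
    show "cmod (bilin ((B + B') *v cvec \<eta>) (cvec (transpose A *v \<zeta>))) \<le> (C + C') * orbit_size A N \<eta> \<zeta>"
      unfolding matrix_vector_mult_add_rdistrib bilin_add_left distrib_right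
      by (intro norm_triangle_le add_mono C(2) C'(2))
  qed (use C C' in auto)
qed

lemma controlled_scale:
  assumes "controlled A N B"
  shows "controlled A N (mat c ** B)"
proof -
  obtain C where C: "C \<ge> 0" "\<And>\<eta> \<zeta>. cmod (bilin (B *v cvec \<eta>) (cvec (transpose A *v \<zeta>))) \<le> C * orbit_size A N \<eta> \<zeta>"
    using assms(1) unfolding controlled_def by blast
  show ?thesis
    unfolding controlled_def
  proof (intro exI[of _ "cmod c * C"] conjI allI)
    fix \<eta> \<zeta>
    show "cmod (bilin ((mat c ** B) *v cvec \<eta>) (cvec (transpose A *v \<zeta>))) \<le> cmod c * C * orbit_size A N \<eta> \<zeta>"
      unfolding mat_mult_vector bilin_scale_left norm_mult mult.assoc
      by (intro mult_left_mono C(2)) simp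
  qed (use C in auto)
qed

lemma controlled_diff:
  assumes "controlled A N B" "controlled A N B'"
  shows "controlled A N (B - B')"
proof -
  have "B - B' = B + mat (-1) ** B'" by (simp add: vec_eq_iff)
  then show ?thesis using assms by (simp only: controlled_add controlled_scale)
qed

lemma controlled_sum: "(\<And>i. i \<in> I \<Longrightarrow> controlled A N (B i)) \<Longrightarrow> controlled A N (\<Sum>i\<in>I. B i)"
  by (induction I rule: infinite_finite_induct) (auto intro: controlled_0 controlled_add)

context
  fixes A :: "real^'n^'n" and p :: "real poly"
  assumes annihilates: "poly_mat p A = 0" and monic: "lead_coeff p = 1"
begin

lemma controlled_matpow: "controlled A (degree p) (matpow (cmat A) l)"
proof -
  obtain C where C: "C \<ge> 0" "\<And>a :: nat \<Rightarrow> real. (\<And>n. a (n + degree p) = - (\<Sum>r<degree p. coeff p r * a (n + r)))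
      \<Longrightarrow> \<bar>a l\<bar> \<le> C * sqrt (\<Sum>r<degree p. (a r)\<^sup>2)"
    using linear_recurrence_bound[of "degree p" "coeff p" l] by blast
  have "cmod (bilin (matpow (cmat A) l *v cvec \<eta>) (cvec (transpose A *v \<zeta>)))
      \<le> C * orbit_size A (degree p) \<eta> \<zeta>" for \<eta> \<zeta>
  proof -
    have "bilin (matpow (cmat A) l *v cvec \<eta>) (cvec (transpose A *v \<zeta>))
        = complex_of_real (orbit_coeff A \<eta> \<zeta> (Suc l))"
      by (simp only: cmat_matpow[symmetric] cmat_mult_cvec bilin_cvec orbit_coeff_Suc)
    moreover have "\<bar>orbit_coeff A \<eta> \<zeta> (Suc l)\<bar> \<le> C * orbit_size A (degree p) \<eta> \<zeta>"
      unfolding orbit_size_def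
      using orbit_coeff_recurrence[OF annihilates monic, of \<eta> \<zeta> "Suc _"]
      by (intro C(2)[of "\<lambda>l. orbit_coeff A \<eta> \<zeta> (Suc l)"]) simp
    ultimately show ?thesis by simp
  qed
  with C(1) show ?thesis unfolding controlled_def by blast
qed

text \<open>
  Expanding one factor \<open>A - g\<close> at a time, with the power of \<open>A\<close> to its right arbitrary.
\<close>

lemma controlled_shifted_power: "controlled A (degree p) (matpow (cmat A - mat g) j ** matpow (cmat A) l)"
proof (induction j arbitrary: l)
  case 0
  then show ?case by (simp add: controlled_matpow)
next
  case (Suc j)
  have "matpow (cmat A - mat g) (Suc j) ** matpow (cmat A) l
      = matpow (cmat A - mat g) j ** ((cmat A - mat g) ** matpow (cmat A) l)"
    by (simp add: matpow_Suc_right matrix_mul_assoc)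
  also have "\<dots> = matpow (cmat A - mat g) j ** matpow (cmat A) (Suc l)
      - mat g ** (matpow (cmat A - mat g) j ** matpow (cmat A) l)"
    by (simp only: matrix_diff_rdistrib matrix_diff_ldistrib matpow_Suc mult_mat_left_commute)
  finally show ?case using Suc by (simp add: controlled_diff controlled_scale)
qed

lemma controlled_shifted_poly: "controlled A (degree p) (matpow (cmat A - mat g) j ** poly_mat q (cmat A))"
  unfolding poly_mat_def matrix_mult_sum_right mult_mat_left_commute
  by (intro controlled_sum controlled_scale controlled_shifted_power)

lemma J_sum_le_orbit_size:
  "\<exists>C\<ge>0. \<forall>\<eta> \<zeta>. J_sum k \<gamma> m P A \<eta> \<zeta> \<le> C * orbit_size A (degree p) \<eta> \<zeta>"
proof -
  have "\<exists>C\<ge>0. \<forall>\<eta> \<zeta>. cmod (bilin ((matpow (cmat A - mat (\<gamma> i)) j ** poly_mat (P i) (cmat A)) *v cvec \<eta>)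
      (cvec (transpose A *v \<zeta>))) \<le> C * orbit_size A (degree p) \<eta> \<zeta>" for i j
    using controlled_shifted_poly unfolding controlled_def by blast
  then obtain C where C: "\<And>i j. C i j \<ge> 0" "\<And>i j \<eta> \<zeta>. cmod (bilin ((matpow (cmat A - mat (\<gamma> i)) j ** poly_mat (P i) (cmat A)) *v cvec \<eta>)
      (cvec (transpose A *v \<zeta>))) \<le> C i j * orbit_size A (degree p) \<eta> \<zeta>"
    by metis
  show ?thesis
  proof (intro exI[of _ "\<Sum>i=1..k. \<Sum>j<m i. C i j"] conjI allI)
    show "0 \<le> (\<Sum>i=1..k. \<Sum>j<m i. C i j)" by (intro sum_nonneg C)
    show "J_sum k \<gamma> m P A \<eta> \<zeta> \<le> (\<Sum>i=1..k. \<Sum>j<m i. C i j) * orbit_size A (degree p) \<eta> \<zeta>" for \<eta> \<zeta>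
      unfolding J_sum_def sum_distrib_right by (intro sum_mono C)
  qed
qed

end

lemma J_sum_nonneg: "0 \<le> J_sum k \<gamma> m P A \<eta> \<zeta>"
  unfolding J_sum_def by (intro sum_nonneg) auto

lemma J_sum_cong:
  "(\<And>i. i \<in> {1..k} \<Longrightarrow> poly_mat (P i) (cmat A) = poly_mat (P' i) (cmat A)) \<Longrightarrow>
    J_sum k \<gamma> m P A \<eta> \<zeta> = J_sum k \<gamma> m P' A \<eta> \<zeta>"
  unfolding J_sum_def by (intro sum.cong) auto

section \<open>The estimate\<close>

text \<open>
  The substitution \<open>t = exp s\<close> makes the power an exponential, at the price of the amplitude \<open>exp s\<close>.
\<close>

lemma integral_mat_rpow_phase:
  assumes "0 < a" "a \<le> b"
  shows "integral {a..b} (\<lambda>t. exp (\<i> * complex_of_real ((mat_rpow t A *v \<eta>) \<bullet> \<zeta>)))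
    = integral {ln a..ln b} (\<lambda>s. cis (egf (orbit_coeff A \<eta> \<zeta>) 0 s) * complex_of_real (exp s))"
proof -
  let ?F = "egf (orbit_coeff A \<eta> \<zeta>) 0"
  have F_cont: "continuous_on S ?F" for S
    by (rule DERIV_continuous_on[OF has_field_derivative_at_within[OF egf_deriv[OF orbit_coeff_geometric]]])
  have cont: "continuous_on {a..b} (\<lambda>t. cis (?F (ln t)))"
  proof (intro continuous_on_cis continuous_on_compose2[OF F_cont[of UNIV]])
    show "continuous_on {a..b} ln" using assms by (intro continuous_on_ln continuous_on_id) auto
  qed simp
  have "((\<lambda>s. exp s *\<^sub>R cis (?F (ln (exp s)))) has_integral
      integral {exp (ln a)..exp (ln b)} (\<lambda>t. cis (?F (ln t)))) {ln a..ln b}"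
  proof (rule has_integral_substitution[OF _ _ _ cont])
    have "exp ` {ln a..ln b} \<subseteq> {exp (ln a)..exp (ln b)}" by auto
    then show "exp ` {ln a..ln b} \<subseteq> {a..b}" using assms by simp
  qed (use assms in \<open>auto intro!: derivative_eq_intros\<close>)
  then have "integral {ln a..ln b} (\<lambda>s. cis (?F s) * complex_of_real (exp s)) = integral {a..b} (\<lambda>t. cis (?F (ln t)))"
    using assms by (simp add: integral_unique scaleR_conv_of_real mult.commute)
  then show ?thesis
    by (simp add: mat_rpow_def mat_exp_inner cis_conv_exp)
qed

theorem theorem5:
  fixes A :: "real^'n^'n" and \<phi> :: "real poly"
    and k :: nat and \<gamma> :: "nat \<Rightarrow> complex" and m :: "nat \<Rightarrow> nat"
    and c d :: real
  assumes "CARD('n) \<ge> 2"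
    and "is_minimal_poly A \<phi>"
    and "cpoly \<phi> = (\<Prod>i=1..k. [:- \<gamma> i, 1:] ^ m i)"
    and "inj_on \<gamma> {1..k}"
    and "\<forall>i\<in>{1..k}. m i \<ge> 1"
    and "0 < c"
  shows "\<exists>C::real. \<forall>(\<beta> :: nat \<Rightarrow> complex poly) (\<eta> :: real^'n) (\<zeta> :: real^'n) (a::real) (b::real).
    partial_fractions (cpoly \<phi>) k \<gamma> m \<beta> \<longrightarrow>
    \<eta> \<noteq> 0 \<longrightarrow> \<zeta> \<noteq> 0 \<longrightarrow>
    a < b \<longrightarrow> a \<in> {c..d} \<longrightarrow> b \<in> {c..d} \<longrightarrow>
    J_sum k \<gamma> m (proj_poly (cpoly \<phi>) \<gamma> m \<beta>) A \<eta> \<zeta> \<noteq> 0 \<longrightarrow>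
    cmod (integral {a..b} (\<lambda>t. exp (\<i> * complex_of_real ((mat_rpow t A *v \<eta>) \<bullet> \<zeta>))))
      \<le> C * J_sum k \<gamma> m (proj_poly (cpoly \<phi>) \<gamma> m \<beta>) A \<eta> \<zeta> powr (- 1 / real (degree \<phi>))"
proof (cases "\<exists>\<beta>. partial_fractions (cpoly \<phi>) k \<gamma> m \<beta>")
  case True
  \<comment> \<open>The constant is taken from one fixed decomposition; without any, the claim is vacuous.\<close>
  then obtain \<beta>\<^sub>0 where \<beta>\<^sub>0: "partial_fractions (cpoly \<phi>) k \<gamma> m \<beta>\<^sub>0" by blast
  let ?P = "\<lambda>\<beta>. proj_poly (cpoly \<phi>) \<gamma> m \<beta>"
  let ?N = "degree \<phi>"
  have annihilates: "poly_mat \<phi> A = 0" and monic: "lead_coeff \<phi> = 1"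
    using assms(2) by (auto simp: is_minimal_poly_def)
  have c\<phi>: "poly_mat (cpoly \<phi>) (cmat A) = 0"
    by (simp add: poly_mat_cpoly annihilates) (simp add: cmat_def vec_eq_iff)
  have J_indep: "J_sum k \<gamma> m (?P \<beta>) A \<eta> \<zeta> = J_sum k \<gamma> m (?P \<beta>\<^sub>0) A \<eta> \<zeta>"
    if "partial_fractions (cpoly \<phi>) k \<gamma> m \<beta>" for \<beta> \<eta> \<zeta>
  proof (rule J_sum_cong)
    fix i assume i: "i \<in> {1..k}"
    have "poly_mat (?P \<beta> i - ?P \<beta>\<^sub>0 i) (cmat A) = 0"
      by (rule poly_mat_dvd_0[OF proj_poly_unique[OF assms(3,4) that \<beta>\<^sub>0 i] c\<phi>])
    then show "poly_mat (?P \<beta> i) (cmat A) = poly_mat (?P \<beta>\<^sub>0 i) (cmat A)"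
      using poly_mat_add[of "?P \<beta> i - ?P \<beta>\<^sub>0 i" "?P \<beta>\<^sub>0 i" "cmat A"] by simp
  qed
  obtain C\<^sub>J where C\<^sub>J: "0 \<le> C\<^sub>J"
    "\<And>\<eta> \<zeta>. J_sum k \<gamma> m (?P \<beta>\<^sub>0) A \<eta> \<zeta> \<le> C\<^sub>J * orbit_size A ?N \<eta> \<zeta>"
    using J_sum_le_orbit_size[OF annihilates monic, of k \<gamma> m "?P \<beta>\<^sub>0"] by blast
  obtain C where C: "0 \<le> C" "\<And>D p q. phase_ode D (coeff \<phi>) ?N \<Longrightarrow> ln c \<le> p \<Longrightarrow> p \<le> q \<Longrightarrow> q \<le> ln d \<Longrightarrow>
    0 < phase_ode.energy D ?N 0 \<Longrightarrow>
    cmod (integral {p..q} (\<lambda>s. cis (D 0 s) * complex_of_real (exp s)))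
      \<le> C * sqrt (phase_ode.energy D ?N 0) powr (- 1 / real ?N)"
    using oscillatory_integral_ode_bound[where \<phi> = "coeff \<phi>" and N = ?N and \<alpha> = "ln c" and \<beta> = "ln d"]
    by blast
  show ?thesis
  proof (intro exI[of _ "C * C\<^sub>J powr (1 / real ?N)"] allI impI)
    fix \<beta> :: "nat \<Rightarrow> complex poly" and \<eta> \<zeta> :: "real^'n" and a b :: real
    assume \<beta>: "partial_fractions (cpoly \<phi>) k \<gamma> m \<beta>" and ab: "a < b" "a \<in> {c..d}" "b \<in> {c..d}"
      and J0: "J_sum k \<gamma> m (?P \<beta>) A \<eta> \<zeta> \<noteq> 0"
    define J where "J = J_sum k \<gamma> m (?P \<beta>) A \<eta> \<zeta>"
    define U where "U = orbit_size A ?N \<eta> \<zeta>"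
    let ?D = "egf (orbit_coeff A \<eta> \<zeta>)"
    have J: "0 < J" using J0 J_sum_nonneg[of k \<gamma> m "?P \<beta>" A \<eta> \<zeta>] by (simp add: J_def)
    have JU: "J \<le> C\<^sub>J * U" using C\<^sub>J(2)[of \<eta> \<zeta>] by (simp add: J_def U_def J_indep[OF \<beta>])
    \<comment> \<open>As \<open>J\<close> is positive, so is \<open>U\<close>, which is what the estimate for the oscillatory integral asks for.\<close>
    then have CJU: "0 < C\<^sub>J" "0 < U"
      using J C\<^sub>J(1) orbit_size_nonneg[of A ?N \<eta> \<zeta>] unfolding U_def
      by (metis less_le_trans mult_eq_0_iff order_le_less not_less)+
    interpret phase_ode ?D "coeff \<phi>" ?N by (rule phase_ode_egf[OF annihilates monic])
    have energy_U: "sqrt (energy 0) = U"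
      by (simp add: energy_def U_def orbit_size_def egf_at_0)
    have "cmod (integral {a..b} (\<lambda>t. exp (\<i> * complex_of_real ((mat_rpow t A *v \<eta>) \<bullet> \<zeta>))))
        = cmod (integral {ln a..ln b} (\<lambda>s. cis (?D 0 s) * complex_of_real (exp s)))"
      using ab assms(6) by (subst integral_mat_rpow_phase) auto
    also have "\<dots> \<le> C * U powr (- 1 / real ?N)"
    proof -
      have "0 < energy 0" using CJU(2) energy_U by (metis real_sqrt_gt_0_iff)
      then show ?thesis
        using C(2)[OF phase_ode_axioms, of "ln a" "ln b"] ab assms(6) by (simp add: energy_U)
    qed
    also have "\<dots> \<le> C * (J / C\<^sub>J) powr (- 1 / real ?N)"
      using JU CJU J C(1) by (intro mult_left_mono powr_mono2') (auto simp: field_simps)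
    also have "(J / C\<^sub>J) powr (- 1 / real ?N) = C\<^sub>J powr (1 / real ?N) * J powr (- 1 / real ?N)"
      using J CJU by (simp add: powr_divide powr_minus field_simps)
    finally show "cmod (integral {a..b} (\<lambda>t. exp (\<i> * complex_of_real ((mat_rpow t A *v \<eta>) \<bullet> \<zeta>))))
      \<le> C * C\<^sub>J powr (1 / real ?N) * J_sum k \<gamma> m (?P \<beta>) A \<eta> \<zeta> powr (- 1 / real ?N)"
      by (simp add: J_def mult.assoc)
  qed
qed blast

end
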